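(* For each $k\in[1,n]$ let $S_k$ be a finite subset of $R$, $\psi_k:S_k\to\mathbb{Z}^+$, $E_k\subseteq S_k$, and put $g_k=\prod_{u\in S_k}(x_k-u)^{\psi_k(u)}$, $h_k=\prod_{u\in E_k}(x_k-u)^{\psi_k(u)}$. Fix $t\in\mathbb{Z}^+$ and let $\Lambda=\{\alpha\in\mathbb{N}^n:\sum_i\alpha_i\in\{t-1,t\}\}$. Define $\varphi(\alpha)=\prod_{i=1}^ng_i^{\alpha_i}$ if $\sum_i\alpha_i=t$, and $\varphi(\alpha)=(\prod_{i=1}^ng_i^{\alpha_i})\cdot\prod_{i=1}^n(g_i/h_i)$ if $\sum_i\alpha_i=t-1$, where $g_i/h_i=\prod_{u\in S_i\setminus E_i}(x_i-u)^{\psi_i(u)}$. Let $Q$ be the set of $f\in\Omega$ such that (i) $f(x_1+a_1,\dots,x_n+a_n)_{[\beta]}=0$ for all $a\in(\prod_iS_i)\setminus(\prod_iE_i)$ and $\beta\in\mathbb{N}^n$ with $\sum_i\lfloor\beta_i/\psi_i(a_i)\rfloor\leqslant t-1$, and (ii) $f(x_1+a_1,\dots,x_n+a_n)_{[\beta]}=0$ for all $a\in\prod_iE_i$ and $\beta\in\mathbb{N}^n$ with $\sum_i\lfloor\beta_i/\psi_i(a_i)\rfloor\leqslant t-2$. Then: (1) $Q$ is an ideal of $\Omega$, and $(\varphi(\alpha)\mid\alpha\in\Lambda)$ is a family of monic polynomials contained in $Q$. (2) If every $S_k$ satisfies Condition (D) in $R$, then $(\varphi(\alpha)\mid\alpha\in\Lambda)$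 is a Gröbner basis of $Q$, and every $f\in Q$ can be written $f=\sum_{\alpha\in\Lambda}p(\alpha)\varphi(\alpha)$ with $p(\alpha)\in\Omega$ and $\mathrm{supp}(p(\alpha))+\mathrm{supp}(\varphi(\alpha))\subseteq\Delta(\mathrm{supp}(f))$ for all $\alpha\in\Lambda$. (3) If $\prod_iS_i\neq\emptyset$, $t\geqslant2$, and $(\varphi(\alpha)\mid\alpha\in\Lambda)$ is a Gröbner basis of $Q$, then every $S_k$ satisfies Condition (D) in $R$.
   Context: Let $R$ be a commutative ring with identity $1_R$, $n$ a positive integer, $\mathbb{N}=\{0,1,2,\dots\}$, $\Omega=R[x_1,\dots,x_n]$. For $\alpha,\beta\in\mathbb{N}^n$, $\alpha\leqslant\beta$ means $\alpha_i\leqslant\beta_i$ for all $i$. For $f\in\Omega$, $f_{[\alpha]}$ is the coefficient of $x_1^{\alpha_1}\cdots x_n^{\alpha_n}$ and $\mathrm{supp}(f)=\{\alpha:f_{[\alpha]}\neq0\}$. For $A,B\subseteq\mathbb{N}^n$: $\Delta(A)=\{\beta:\exists\alpha\in A,\beta\leqslant\alpha\}$, $A+B=\{\alpha+\beta\}$. A polynomial $g$ is monic if $\mathrm{supp}(g)$ has a greatest element $\theta$ for $\leqslant$ and $g_{[\theta]}=1_R$. A family $(g(\lambda))_{\lambda\in\Lambda}$ (finite $\Lambda$) of monic polynomials with greatest support elements $\theta(\lambda)$, all in an ideal $Q$, is a Gröbner basis of $Q$ if for every $\tau\in Q\setminus\{0\}$ there are $\alpha\in\mathrm{supp}(\tau)$,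 $r\in\Lambda$ with $\theta(r)\leqslant\alpha$. A subset $X\subseteq R$ satisfies Condition (D) in $R$ if for all $a\neq b$ in $X$, $b-a$ is not a zero divisor of $R$. *)

theory Defs
  imports "HOL-Library.Poly_Mapping" "HOL-Library.Function_Algebras"
    "HOL-Library.Set_Algebras" "HOL-Library.FuncSet"
begin

text \<open>
  The variables are indexed by a finite type \<open>'n\<close> (so \<open>n = CARD('n) \<ge> 1\<close>), exponent vectors are
  functions \<open>'n \<Rightarrow> nat\<close> with pointwise addition and pointwise order, and \<open>R[x\<^sub>1, \<dots>, x\<^sub>n]\<close> is the
  convolution ring of finitely supported maps from exponent vectors to \<open>R\<close>. The coefficient
  \<open>f\<^bsub>[\<alpha>]\<^esub>\<close> is \<open>lookup f \<alpha>\<close> and \<open>supp f\<close> is \<open>keys f\<close>.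

  The class \<open>comm_ring_1\<close> excludes the zero ring. Over the zero ring every support is empty,
  so there are no monic polynomials at all.
\<close>

type_synonym ('n, 'a) mpoly = "('n \<Rightarrow> nat) \<Rightarrow>\<^sub>0 'a"

definition Const :: "'a::comm_ring_1 \<Rightarrow> ('n::finite, 'a) mpoly" where
  "Const c = Poly_Mapping.single 0 c"

definition Var :: "'n::finite \<Rightarrow> ('n, 'a::comm_ring_1) mpoly" where
  "Var k = Poly_Mapping.single (\<lambda>i. if i = k then 1 else 0) 1"

definition subst :: "('n::finite \<Rightarrow> ('n, 'a::comm_ring_1) mpoly) \<Rightarrow> ('n, 'a) mpoly \<Rightarrow> ('n, 'a) mpoly" where
  "subst s f = (\<Sum>\<alpha>\<in>Poly_Mapping.keys f. Const (Poly_Mapping.lookup f \<alpha>) * (\<Prod>i\<in>UNIV. s i ^ \<alpha> i))"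

definition translate :: "('n::finite \<Rightarrow> 'a::comm_ring_1) \<Rightarrow> ('n, 'a) mpoly \<Rightarrow> ('n, 'a) mpoly" where
  "translate a f = subst (\<lambda>i. Var i + Const (a i)) f"

definition down_closure :: "('n \<Rightarrow> nat) set \<Rightarrow> ('n \<Rightarrow> nat) set" (\<open>\<Delta>\<close>) where
  "\<Delta> A = {\<beta>. \<exists>\<alpha>\<in>A. \<beta> \<le> \<alpha>}"

definition greatest_exponent :: "('n::finite, 'a::comm_ring_1) mpoly \<Rightarrow> ('n \<Rightarrow> nat) \<Rightarrow> bool" where
  "greatest_exponent g \<theta> \<longleftrightarrow>
     \<theta> \<in> Poly_Mapping.keys g \<and> (\<forall>\<alpha>\<in>Poly_Mapping.keys g. \<alpha> \<le> \<theta>)"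

definition monic :: "('n::finite, 'a::comm_ring_1) mpoly \<Rightarrow> bool" where
  "monic g \<longleftrightarrow> (\<exists>\<theta>. greatest_exponent g \<theta> \<and> Poly_Mapping.lookup g \<theta> = 1)"

definition is_ideal :: "'r::comm_ring_1 set \<Rightarrow> bool" where
  "is_ideal Q \<longleftrightarrow>
     0 \<in> Q \<and> (\<forall>f\<in>Q. \<forall>g\<in>Q. f + g \<in> Q) \<and> (\<forall>p. \<forall>f\<in>Q. p * f \<in> Q)"

definition groebner_basis ::
  "'l set \<Rightarrow> ('l \<Rightarrow> ('n::finite, 'a::comm_ring_1) mpoly) \<Rightarrow> ('n, 'a) mpoly set \<Rightarrow> bool" where
  "groebner_basis \<Lambda> g Q \<longleftrightarrow>
     finite \<Lambda> \<and> is_ideal Q \<and> (\<forall>r\<in>\<Lambda>. monic (g r) \<and> g r \<in> Q) \<and>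
     (\<forall>\<tau>\<in>Q - {0}. \<exists>\<alpha>\<in>Poly_Mapping.keys \<tau>. \<exists>r\<in>\<Lambda>. \<exists>\<theta>. greatest_exponent (g r) \<theta> \<and> \<theta> \<le> \<alpha>)"

definition zero_divisor :: "'a::comm_ring_1 \<Rightarrow> bool" where
  "zero_divisor z \<longleftrightarrow> (\<exists>c. c \<noteq> 0 \<and> z * c = 0)"

definition condition_D :: "'a::comm_ring_1 set \<Rightarrow> bool" where
  "condition_D X \<longleftrightarrow> (\<forall>a\<in>X. \<forall>b\<in>X. a \<noteq> b \<longrightarrow> \<not> zero_divisor (b - a))"

text \<open>
  \<open>g\<^sub>k\<close> and \<open>h\<^sub>k\<close> are \<open>node_poly \<psi> S k\<close> and \<open>node_poly \<psi> E k\<close>; the quotient \<open>g\<^sub>k/h\<^sub>k\<close> is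
  \<open>node_poly \<psi> (\<lambda>i. S i - E i) k\<close>.
\<close>

definition node_poly ::
  "('n::finite \<Rightarrow> 'a::comm_ring_1 \<Rightarrow> nat) \<Rightarrow> ('n \<Rightarrow> 'a set) \<Rightarrow> 'n \<Rightarrow> ('n, 'a) mpoly" where
  "node_poly \<psi> T k = (\<Prod>u\<in>T k. (Var k - Const u) ^ \<psi> k u)"

lemma node_poly_quotient:
  assumes "finite (S k)" "E k \<subseteq> S k"
  shows "node_poly \<psi> S k = node_poly \<psi> (\<lambda>i. S i - E i) k * node_poly \<psi> E k"
  using assms unfolding node_poly_def by (rule prod.subset_diff[rotated])

definition index_set :: "nat \<Rightarrow> ('n::finite \<Rightarrow> nat) set" where
  "index_set t = {\<alpha>. (\<Sum>i\<in>UNIV. \<alpha> i) \<in> {t - 1, t}}"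

text \<open>Only the values of \<open>basis_poly\<close> on \<open>index_set t\<close> matter.\<close>

definition basis_poly ::
  "('n::finite \<Rightarrow> 'a::comm_ring_1 \<Rightarrow> nat) \<Rightarrow> ('n \<Rightarrow> 'a set) \<Rightarrow> ('n \<Rightarrow> 'a set) \<Rightarrow> nat
     \<Rightarrow> ('n \<Rightarrow> nat) \<Rightarrow> ('n, 'a) mpoly" where
  "basis_poly \<psi> S E t \<alpha> =
     (if (\<Sum>i\<in>UNIV. \<alpha> i) = t then (\<Prod>i\<in>UNIV. node_poly \<psi> S i ^ \<alpha> i)
      else (\<Prod>i\<in>UNIV. node_poly \<psi> S i ^ \<alpha> i) * (\<Prod>i\<in>UNIV. node_poly \<psi> (\<lambda>j. S j - E j) i))"

text \<open>
  The bounds \<open>t - 1\<close> and \<open>t - 2\<close> are taken in the integers: for \<open>t = 1\<close> the second condition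
  is vacuous. Natural number division \<open>div\<close> is the floor of the quotient.
\<close>

definition vanishing_ideal ::
  "('n::finite \<Rightarrow> 'a::comm_ring_1 \<Rightarrow> nat) \<Rightarrow> ('n \<Rightarrow> 'a set) \<Rightarrow> ('n \<Rightarrow> 'a set) \<Rightarrow> nat
     \<Rightarrow> ('n, 'a) mpoly set" where
  "vanishing_ideal \<psi> S E t =
     {f. (\<forall>a \<in> Pi UNIV S - Pi UNIV E. \<forall>\<beta>.
            int (\<Sum>i\<in>UNIV. \<beta> i div \<psi> i (a i)) \<le> int t - 1 \<longrightarrow>
            Poly_Mapping.lookup (translate a f) \<beta> = 0) \<and>
         (\<forall>a \<in> Pi UNIV E. \<forall>\<beta>.
            int (\<Sum>i\<in>UNIV. \<beta> i div \<psi> i (a i)) \<le> int t - 2 \<longrightarrow>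
            Poly_Mapping.lookup (translate a f) \<beta> = 0)}"

end

theory Submission
  imports "HOL-Computational_Algebra.Polynomial" Defs
begin

text \<open>
  List the nodes of \<open>S\<^sub>i\<close> with multiplicities \<open>\<psi>\<^sub>i\<close>, those outside \<open>E\<^sub>i\<close> first, and repeat this list
  periodically. The Newton polynomials of the resulting sequence include all the powers of \<open>g\<^sub>i\<close> and
  their products with \<open>g\<^sub>i/h\<^sub>i\<close>, so every \<open>\<phi>(\<alpha>)\<close> is a product of Newton polynomials, one in each
  variable. Expand \<open>f \<in> Q\<close> in these products. To each index \<open>\<beta>\<close> belongs one coefficient of one
  translate of \<open>f\<close>, and this system of functionals is triangular with diagonal entries that are
  products of differences of nodes. If \<open>\<beta>\<close> lies above no \<open>\<theta>(\<alpha>)\<close>, then the functional at \<open>\<beta>\<close> is one of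
  those that vanish on \<open>Q\<close>, so under Condition (D) only indices above some \<open>\<theta>(\<alpha>)\<close> survive, and there
  the Newton product is a multiple of \<open>\<phi>(\<alpha>)\<close>. This gives (2).

  For (3), if \<open>c (b - a) = 0\<close> with \<open>c \<noteq> 0\<close> and \<open>a \<noteq> b\<close> in \<open>S\<^sub>k\<close>, then multiplication by \<open>c\<close> makes one
  factor \<open>x\<^sub>k - b\<close> of a suitable product of powers of the \<open>g\<^sub>i\<close> and \<open>g\<^sub>i/h\<^sub>i\<close> redundant, which leaves
  a nonzero element of \<open>Q\<close> of too small degree. The product is \<open>g\<^sub>k\<^sup>t\<close> if some \<open>E\<^sub>i\<close> is empty, and
  \<open>\<phi>((t - 1) e\<^sub>k)\<close> otherwise.
\<close>

subsection \<open>Monomials\<close>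

lemma Const_0 [simp]: "Const 0 = 0"
  by (simp add: Const_def)

lemma Const_1 [simp]: "Const 1 = 1"
  by (simp add: Const_def)

lemma Const_add: "Const (a + b) = Const a + Const b"
  by (simp add: Const_def single_add)

lemma Const_mult: "Const (a * b) = Const a * Const b"
  by (simp add: Const_def mult_single)

lemma Const_uminus: "Const (- a) = - Const a"
  by (simp add: Const_def single_uminus)

lemma Const_times_single: "Const c * Poly_Mapping.single \<alpha> b = Poly_Mapping.single \<alpha> (c * b)"
  by (simp add: Const_def mult_single)

lemma lookup_Const_mult: "Poly_Mapping.lookup (Const c * f) \<alpha> = c * Poly_Mapping.lookup f \<alpha>"
  by (simp add: Const_def mult_map_scale_conv_mult [symmetric] Poly_Mapping.map.rep_eq when_def)

lemma Var_power:
  "(Var k :: ('n::finite, 'a::comm_ring_1) mpoly) ^ m = Poly_Mapping.single (\<lambda>i. if i = k then m else 0) 1"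
proof (induction m)
  case 0
  have "(\<lambda>i. if i = k then 0 else 0) = (0 :: 'n \<Rightarrow> nat)"
    by (auto simp: zero_fun_def)
  then show ?case
    by simp
next
  case (Suc m)
  then show ?case
    by (auto simp: Var_def mult_single fun_eq_iff plus_fun_def intro!: arg_cong2[of _ _ _ _ Poly_Mapping.single])
qed

lemma prod_single:
  "(\<Prod>i\<in>A. Poly_Mapping.single (\<beta> i) (c i)) = Poly_Mapping.single (\<Sum>i\<in>A. \<beta> i) (\<Prod>i\<in>A. c i :: 'a::comm_ring_1)"
  by (induction A rule: infinite_finite_induct) (simp_all add: mult_single)

lemma sum_fun_axis:
  "(\<Sum>k\<in>UNIV. (\<lambda>i. if i = k then \<beta> k else 0)) = (\<beta> :: 'n::finite \<Rightarrow> nat)"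
proof
  fix j
  have "(\<Sum>k\<in>A. (\<lambda>i. if i = k then \<beta> k else 0)) j = (\<Sum>k\<in>A. if j = k then \<beta> k else 0)"
    if "finite A" for A
    using that by (induction A) auto
  from this[of UNIV] show "(\<Sum>k\<in>UNIV. (\<lambda>i. if i = k then \<beta> k else 0)) j = \<beta> j"
    by simp
qed

definition monomial :: "('n::finite \<Rightarrow> nat) \<Rightarrow> ('n, 'a::comm_ring_1) mpoly" where
  "monomial \<alpha> = (\<Prod>i\<in>UNIV. Var i ^ \<alpha> i)"

lemma monomial_eq: "monomial \<alpha> = Poly_Mapping.single \<alpha> 1"
  by (simp add: monomial_def Var_power prod_single sum_fun_axis)

lemma monomial_expansion:
  assumes "finite A" "Poly_Mapping.keys f \<subseteq> A"
  shows "f = (\<Sum>\<alpha>\<in>A. Const (Poly_Mapping.lookup f \<alpha>) * monomial \<alpha>)"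
  using assms
  by (intro poly_mapping_eqI)
    (auto simp: lookup_sum monomial_eq Const_times_single lookup_single when_def in_keys_iff)

subsection \<open>Substitution\<close>

text \<open>Terms outside the support contribute zero, so two polynomials can be summed over a
  common index set.\<close>

lemma subst_eq_sum:
  assumes "finite A" "Poly_Mapping.keys f \<subseteq> A"
  shows "subst s f = (\<Sum>\<alpha>\<in>A. Const (Poly_Mapping.lookup f \<alpha>) * (\<Prod>i\<in>UNIV. s i ^ \<alpha> i))"
  unfolding subst_def using assms
  by (intro sum.mono_neutral_left) (auto simp: in_keys_iff)

lemma subst_0 [simp]: "subst s 0 = 0"
  by (simp add: subst_def)

lemma subst_add: "subst s (f + g) = subst s f + subst s g"
proof -
  let ?A = "Poly_Mapping.keys f \<union> Poly_Mapping.keys g"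
  have "Poly_Mapping.keys (f + g) \<subseteq> ?A"
    by (rule keys_add)
  then show ?thesis
    by (simp add: subst_eq_sum[of ?A] lookup_add Const_add algebra_simps sum.distrib)
qed

lemma subst_sum: "subst s (\<Sum>x\<in>A. f x) = (\<Sum>x\<in>A. subst s (f x))"
  by (induction A rule: infinite_finite_induct) (simp_all add: subst_add)

lemma subst_single:
  "subst s (Poly_Mapping.single \<alpha> c) = Const c * (\<Prod>i\<in>UNIV. s i ^ \<alpha> i)"
  by (subst subst_eq_sum[of "{\<alpha>}"]) auto

text \<open>Both sides are additive in each factor, which reduces the claim to two single terms,
  where it is the law of exponents.\<close>

lemma subst_mult:
  fixes f g :: "('n::finite, 'a::comm_ring_1) mpoly"
  shows "subst s (f * g) = subst s f * subst s g"
proof -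
  have exp: "f = (\<Sum>\<alpha>\<in>Poly_Mapping.keys f. Poly_Mapping.single \<alpha> (Poly_Mapping.lookup f \<alpha>))"
    for f :: "('n, 'a) mpoly"
    using monomial_expansion[of "Poly_Mapping.keys f" f] by (simp add: monomial_eq Const_times_single)
  have single: "subst s (Poly_Mapping.single \<alpha> c * Poly_Mapping.single \<beta> d) =
      subst s (Poly_Mapping.single \<alpha> c) * subst s (Poly_Mapping.single \<beta> d)" for \<alpha> \<beta> c d
    by (simp add: subst_single mult_single Const_mult plus_fun_def power_add prod.distrib algebra_simps)
  let ?F = "\<lambda>f. \<Sum>\<alpha>\<in>Poly_Mapping.keys f. Poly_Mapping.single \<alpha> (Poly_Mapping.lookup f \<alpha>)"
  have "subst s (?F f * ?F g) = subst s (?F f) * subst s (?F g)"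
    by (simp add: sum_product subst_sum single)
  then show ?thesis
    by (simp only: exp[symmetric])
qed

lemma subst_1: "subst s 1 = 1"
  unfolding single_one[symmetric] subst_single Const_def by (simp add: zero_fun_def)

lemma subst_prod: "subst s (\<Prod>x\<in>A. f x) = (\<Prod>x\<in>A. subst s (f x))"
  by (induction A rule: infinite_finite_induct) (simp_all add: subst_1 subst_mult)

lemma subst_Const [simp]: "subst s (Const c) = Const c"
  by (simp add: subst_single Const_def[of c] zero_fun_def flip: Const_def)

lemma subst_Var [simp]: "subst s (Var k) = s k"
proof -
  have "(\<Prod>i\<in>UNIV. s i ^ (if i = k then 1 else 0)) = (\<Prod>i\<in>UNIV. if i = k then s i else 1)"
    by (intro prod.cong) auto
  then show ?thesis
    unfolding Var_def by (simp add: subst_single)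
qed

subsection \<open>Products of univariate polynomials in separate variables\<close>

text \<open>Lifting the coefficients and evaluating at \<open>Var k\<close> gives the Horner
  recursion \<open>uni_pCons\<close>, on which the inductions over \<open>p\<close> rest.\<close>

definition uni :: "'n::finite \<Rightarrow> 'a::comm_ring_1 poly \<Rightarrow> ('n, 'a) mpoly" where
  "uni k p = poly (map_poly Const p) (Var k)"

lemma uni_0 [simp]: "uni k 0 = 0"
  by (simp add: uni_def)

lemma uni_pCons: "uni k (pCons c p) = Const c + Var k * uni k p"
  by (simp add: uni_def map_poly_pCons)

lemma uni_1 [simp]: "uni k 1 = 1"
  by (simp add: one_pCons uni_pCons)

lemma uni_add: "uni k (p + q) = uni k p + uni k q"
  by (induction p q rule: poly_induct2) (simp_all add: uni_pCons Const_add algebra_simps)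

lemma uni_smult: "uni k (smult c p) = Const c * uni k p"
  by (induction p) (simp_all add: uni_pCons Const_mult algebra_simps)

lemma uni_mult: "uni k (p * q) = uni k p * uni k q"
  by (induction p) (simp_all add: uni_pCons uni_add uni_smult algebra_simps)

lemma uni_power: "uni k (p ^ m) = uni k p ^ m"
  by (induction m) (simp_all add: uni_mult)

lemma uni_prod: "uni k (\<Prod>x\<in>A. p x) = (\<Prod>x\<in>A. uni k (p x))"
  by (induction A rule: infinite_finite_induct) (simp_all add: uni_mult)

lemma uni_sum: "uni k (\<Sum>x\<in>A. p x) = (\<Sum>x\<in>A. uni k (p x))"
  by (induction A rule: infinite_finite_induct) (simp_all add: uni_add)

lemma uni_monom: "uni k (monom c m) = Const c * Var k ^ m"
  by (induction m) (simp_all add: monom_0 monom_Suc uni_pCons algebra_simps)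

lemma uni_eq_sum:
  "uni k p = (\<Sum>m\<le>degree p. Poly_Mapping.single (\<lambda>i. if i = k then m else 0) (coeff p m))"
  by (subst poly_as_sum_of_monoms[of p, symmetric])
    (simp add: uni_sum uni_monom Var_power Const_times_single)

lemma subst_uni: "subst s (uni k p) = poly (map_poly Const p) (s k)"
  by (induction p) (simp_all add: uni_pCons subst_add subst_mult map_poly_pCons)

lemma translate_uni: "translate a (uni k p) = uni k (pcompose p [:a k, 1:])"
  unfolding translate_def subst_uni
  by (induction p)
    (simp_all add: map_poly_pCons pcompose_pCons uni_pCons uni_add uni_mult uni_smult algebra_simps)

text \<open>The pure tensor of the \<open>p i\<close>, with the polynomial ring seen as the tensor
  product of the univariate rings.\<close>

definition tens :: "('n::finite \<Rightarrow> 'a::comm_ring_1 poly) \<Rightarrow> ('n, 'a) mpoly" where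
  "tens p = (\<Prod>i\<in>UNIV. uni i (p i))"

lemma lookup_tens:
  "Poly_Mapping.lookup (tens p) \<beta> = (\<Prod>i\<in>UNIV. coeff (p i) (\<beta> i))"
proof -
  let ?B = "PiE UNIV (\<lambda>i. {..degree (p i)})"
  have "tens p = (\<Sum>\<gamma>\<in>?B. Poly_Mapping.single \<gamma> (\<Prod>i\<in>UNIV. coeff (p i) (\<gamma> i)))"
    unfolding tens_def uni_eq_sum
    by (subst prod_sum_PiE) (auto simp: prod_single sum_fun_axis)
  moreover have "finite ?B"
    by (intro finite_PiE) auto
  \<comment> \<open>Outside the box of degree bounds the left side has no term, so the product has
    to vanish there too.\<close>
  moreover have "(\<Prod>i\<in>UNIV. coeff (p i) (\<beta> i)) = 0" if "\<beta> \<notin> ?B"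
  proof -
    from that obtain i where "\<beta> i > degree (p i)"
      by (auto simp: PiE_iff not_le)
    then have "coeff (p i) (\<beta> i) = 0"
      by (rule coeff_eq_0)
    then show ?thesis
      by (intro prod_zero) auto
  qed
  ultimately show ?thesis
    by (auto simp: lookup_sum lookup_single when_def)
qed

lemma tens_mult: "tens p * tens q = tens (\<lambda>i. p i * q i)"
  by (simp add: tens_def uni_mult prod.distrib)

lemma translate_tens: "translate a (tens p) = tens (\<lambda>i. pcompose (p i) [:a i, 1:])"
  unfolding tens_def translate_uni[symmetric] by (simp add: translate_def subst_prod)

lemma keys_tens_le:
  assumes "\<And>i. degree (p i) \<le> \<theta> i" "\<beta> \<in> Poly_Mapping.keys (tens p)"
  shows "\<beta> \<le> \<theta>"
proof (rule le_funI)
  fix i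
  have "coeff (p i) (\<beta> i) \<noteq> 0"
    using assms(2) prod_zero[of UNIV "\<lambda>i. coeff (p i) (\<beta> i)"] by (auto simp: in_keys_iff lookup_tens)
  then show "\<beta> i \<le> \<theta> i"
    using assms(1)[of i] le_degree order_trans by blast
qed

lemma greatest_exponent_tens:
  assumes "\<And>i. degree (p i) \<le> \<theta> i" "(\<Prod>i\<in>UNIV. coeff (p i) (\<theta> i)) \<noteq> 0"
  shows "greatest_exponent (tens p) \<theta>"
  using assms keys_tens_le[of p \<theta>]
  by (auto simp: greatest_exponent_def in_keys_iff lookup_tens)

lemma greatest_exponent_unique:
  "greatest_exponent g \<theta> \<Longrightarrow> greatest_exponent g \<eta> \<Longrightarrow> \<theta> = \<eta>"
  by (auto simp: greatest_exponent_def intro: antisym)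

text \<open>Only degree bounds are assumed, so zero divisors cause no trouble: if one of the bounds
  is strict, both sides are zero.\<close>

lemma coeff_mult_top:
  fixes p q :: "'a::comm_ring_1 poly"
  assumes "degree p \<le> m" "degree q \<le> n"
  shows "coeff (p * q) (m + n) = coeff p m * coeff q n"
proof (cases "degree p = m \<and> degree q = n")
  case True
  then show ?thesis
    using coeff_mult_degree_sum[of p q] by simp
next
  case False
  then have less: "degree p < m \<or> degree q < n"
    using assms by auto
  then have "coeff p m * coeff q n = 0"
    by (auto simp: coeff_eq_0)
  moreover have "degree (p * q) < m + n"
    using degree_mult_le[of p q] less assms by auto
  ultimately show ?thesis
    by (simp add: coeff_eq_0)
qed

text \<open>The shift turns X - v into X, so X^m divides the shifted polynomial.\<close>

lemma pcompose_shift_eq_0: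
  fixes p :: "'a::comm_ring_1 poly"
  assumes "[:- v, 1:] ^ m dvd p" "j < m"
  shows "coeff (pcompose p [:v, 1:]) j = 0"
proof -
  obtain q where "p = [:- v, 1:] ^ m * q"
    using assms(1) by auto
  moreover have "pcompose (r ^ m) [:v, 1:] = pcompose r [:v, 1:] ^ m" for r :: "'a poly"
    by (induction m) (simp_all add: pcompose_mult pcompose_1)
  ultimately have "pcompose p [:v, 1:] = monom 1 m * pcompose q [:v, 1:]"
    by (simp add: pcompose_mult pcompose_pCons monom_altdef)
  then show ?thesis
    using assms(2) by (simp add: coeff_monom_mult)
qed

subsection \<open>Newton polynomials\<close>

definition newton :: "(nat \<Rightarrow> 'a::comm_ring_1) \<Rightarrow> nat \<Rightarrow> 'a poly" where
  "newton u k = (\<Prod>l<k. [:- u l, 1:])"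

text \<open>As in Hermite interpolation, this is the order of the Taylor coefficient at
  \<open>u k\<close> that serves as the functional of index \<open>k\<close>.\<close>

definition rep :: "(nat \<Rightarrow> 'a) \<Rightarrow> nat \<Rightarrow> nat" where
  "rep u k = card {l. l < k \<and> u l = u k}"

lemma newton_Suc: "newton u (Suc k) = newton u k * [:- u k, 1:]"
  by (simp add: newton_def)

lemma degree_newton_le: "degree (newton u k) \<le> k"
proof (induction k)
  case (Suc k)
  then show ?case
    using degree_mult_le[of "newton u k" "[:- u k, 1:]"] by (simp add: newton_Suc)
qed (simp add: newton_def)

lemma coeff_newton [simp]: "coeff (newton u k) k = 1"
proof (induction k)
  case (Suc k)
  then show ?case
    using coeff_mult_top[of "newton u k" k "[:- u k, 1:]" 1] by (simp add: newton_Suc degree_newton_le)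
qed (simp add: newton_def)

lemma newton_add: "newton u (k + m) = newton u k * newton (\<lambda>l. u (k + l)) m"
  by (induction m) (simp_all add: newton_def algebra_simps)

text \<open>After the shift each factor with node \<open>a\<close> is X; these factors only move the
  coefficients of the rest up by \<open>c\<close>.\<close>

lemma newton_shift:
  "coeff (pcompose (newton u k) [:a, 1:]) j =
     (let c = card {l. l < k \<and> u l = a}
      in if j < c then 0 else coeff (\<Prod>l\<in>{l. l < k \<and> u l \<noteq> a}. [:a - u l, 1:]) (j - c))"
proof -
  have "pcompose (newton u k) [:a, 1:] = (\<Prod>l<k. [:a - u l, 1:])"
    by (simp add: newton_def pcompose_prod pcompose_pCons)
  also have "{..<k} = {l. l < k \<and> u l = a} \<union> {l. l < k \<and> u l \<noteq> a}"
    by auto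
  also have "(\<Prod>l\<in>\<dots>. [:a - u l, 1:]) =
      (\<Prod>l\<in>{l. l < k \<and> u l = a}. [:a - u l, 1:]) * (\<Prod>l\<in>{l. l < k \<and> u l \<noteq> a}. [:a - u l, 1:])"
    by (rule prod.union_disjoint) auto
  also have "(\<Prod>l\<in>{l. l < k \<and> u l = a}. [:a - u l, 1:]) = (\<Prod>l\<in>{l. l < k \<and> u l = a}. [:0, 1:])"
    by (rule prod.cong) auto
  also have "\<dots> = monom 1 (card {l. l < k \<and> u l = a})"
    by (simp add: monom_altdef)
  finally show ?thesis
    by (simp add: coeff_monom_mult Let_def)
qed

text \<open>Position \<open>k\<close> itself is one more occurrence of \<open>u k\<close> before
  \<open>k'\<close>, so the shifted polynomial starts beyond order \<open>rep u k\<close>.\<close>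

lemma newton_shift_above:
  assumes "k < k'"
  shows "coeff (pcompose (newton u k') [:u k, 1:]) (rep u k) = 0"
proof -
  have "rep u k < card {l. l < k' \<and> u l = u k}"
    unfolding rep_def using assms by (intro psubset_card_mono) auto
  then show ?thesis
    by (simp add: newton_shift)
qed

text \<open>Here the power of X split off is exactly \<open>rep u k\<close>, which leaves the
  constant term of the remaining factors.\<close>

lemma newton_shift_diag:
  "coeff (pcompose (newton u k) [:u k, 1:]) (rep u k) = (\<Prod>l\<in>{l. l < k \<and> u l \<noteq> u k}. u k - u l)"
  by (simp add: newton_shift rep_def poly_0_coeff_0[symmetric] poly_prod)

text \<open>Induction by multiplying with X, since X N_k = N_{k+1} + u_k N_k for the Newton
  polynomials N_k.\<close>

lemma newton_expansion:
  "\<exists>s. monom 1 m = (\<Sum>k\<le>m. smult (s k) (newton u k))"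
proof (induction m)
  case 0
  show ?case
    by (rule exI[of _ "\<lambda>_. 1"]) (simp add: newton_def monom_0)
next
  case (Suc m)
  then obtain s where s: "monom 1 m = (\<Sum>k\<le>m. smult (s k) (newton u k))"
    by blast
  \<comment> \<open>The first summand comes from N_{k+1}, with its index moved up by one, the second
    from u_k N_k.\<close>
  define s' where "s' k = (if k = 0 then 0 else s (k - 1)) + (if k \<le> m then s k * u k else 0)" for k
  have X: "[:0, 1:] * newton u k = newton u (Suc k) + smult (u k) (newton u k)" for k
    by (simp add: newton_Suc)
  have "monom 1 (Suc m) = [:0, 1:] * monom (1::'a) m"
    by (simp add: monom_Suc)
  also have "\<dots> = (\<Sum>k\<le>m. smult (s k) ([:0, 1:] * newton u k))"
    by (subst s) (simp only: sum_distrib_left mult_smult_right)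
  also have "\<dots> = (\<Sum>k\<le>m. smult (s k) (newton u (Suc k))) + (\<Sum>k\<le>m. smult (s k * u k) (newton u k))"
    unfolding X by (simp add: smult_add_right sum.distrib)
  also have "(\<Sum>k\<le>m. smult (s k) (newton u (Suc k))) =
      (\<Sum>k\<le>Suc m. smult (if k = 0 then 0 else s (k - 1)) (newton u k))"
    by (simp add: sum.atMost_Suc_shift del: sum.atMost_Suc)
  also have "(\<Sum>k\<le>m. smult (s k * u k) (newton u k)) =
      (\<Sum>k\<le>Suc m. smult (if k \<le> m then s k * u k else 0) (newton u k))"
    by simp
  finally have "monom 1 (Suc m) = (\<Sum>k\<le>Suc m. smult (s' k) (newton u k))"
    unfolding s'_def smult_add_left sum.distrib .
  then show ?case
    by blast
qed

section \<open>Periodic node sequences\<close>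

lemma prod_lessThan_periodic:
  fixes f :: "nat \<Rightarrow> 'b::comm_monoid_mult"
  assumes "\<And>l. f (d + l) = f l"
  shows "(\<Prod>l<q * d + r. f l) = (\<Prod>l<d. f l) ^ q * (\<Prod>l<r. f l)"
proof (induction q)
  case (Suc q)
  have "(\<Prod>l<d + n. f l) = (\<Prod>l<d. f l) * (\<Prod>l<n. f l)" for n
    by (induction n) (simp_all add: assms mult.assoc)
  from this[of "q * d + r"] show ?case
    using Suc.IH by (simp add: ac_simps)
qed simp

lemma sum_lessThan_periodic:
  fixes f :: "nat \<Rightarrow> nat"
  assumes "\<And>l. f (d + l) = f l"
  shows "(\<Sum>l<q * d + r. f l) = q * (\<Sum>l<d. f l) + (\<Sum>l<r. f l)"
proof (induction q)
  case (Suc q)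
  have "(\<Sum>l<d + n. f l) = (\<Sum>l<d. f l) + (\<Sum>l<n. f l)" for n
    by (induction n) (simp_all add: assms)
  from this[of "q * d + r"] show ?case
    using Suc.IH by (simp add: ac_simps)
qed simp

abbreviation (input) node_upoly :: "('a::comm_ring_1 \<Rightarrow> nat) \<Rightarrow> 'a set \<Rightarrow> 'a poly" where
  "node_upoly \<psi> T \<equiv> \<Prod>v\<in>T. [:- v, 1:] ^ \<psi> v"

lemma node_list:
  fixes \<psi> :: "'a::comm_ring_1 \<Rightarrow> nat"
  assumes "finite T"
  obtains xs where "set xs \<subseteq> T" "\<And>v. count_list xs v = (if v \<in> T then \<psi> v else 0)" "length xs = sum \<psi> T"
    "(\<Prod>v\<leftarrow>xs. [:- v, 1:]) = node_upoly \<psi> T"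
proof -
  have "\<exists>xs. set xs \<subseteq> T \<and> (\<forall>v. count_list xs v = (if v \<in> T then \<psi> v else 0)) \<and> length xs = sum \<psi> T \<and>
    (\<Prod>v\<leftarrow>xs. [:- v, 1:]) = node_upoly \<psi> T"
    using assms
  proof induction
    case (insert w T)
    then obtain xs where "set xs \<subseteq> T" "\<forall>v. count_list xs v = (if v \<in> T then \<psi> v else 0)"
      "length xs = sum \<psi> T" "(\<Prod>v\<leftarrow>xs. [:- v, 1:]) = node_upoly \<psi> T"
      by blast
    moreover have "count_list (replicate m w) v = (if v = w then m else 0)" for m v
      by (induction m) auto
    ultimately show ?case
      using insert.hyps by (intro exI[of _ "replicate (\<psi> w) w @ xs"]) auto
  qed auto
  then show thesis
    using that by blast
qed

text \<open>The sequence runs periodically through a list of \<open>S\<close> with multiplicities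
  that puts \<open>S - E\<close> before \<open>E\<close>: cutting after \<open>q\<close> full
  periods gives a power of g, cutting after the \<open>S - E\<close> block of the next period adds
  the factor g/h. The last claim holds because each full period contains a node \<open>v\<close>
  exactly \<open>\<psi> v\<close> times.\<close>

lemma node_sequence:
  fixes \<psi> :: "'a::comm_ring_1 \<Rightarrow> nat"
  assumes fin: "finite S" and pos: "\<And>v. v \<in> S \<Longrightarrow> \<psi> v > 0" and sub: "E \<subseteq> S"
  obtains u where
    "\<And>k. S \<noteq> {} \<Longrightarrow> u k \<in> S"
    "\<And>k. k mod sum \<psi> S < sum \<psi> (S - E) \<Longrightarrow> u k \<in> S - E"
    "\<And>q. newton u (q * sum \<psi> S) = node_upoly \<psi> S ^ q"
    "\<And>q. newton u (q * sum \<psi> S + sum \<psi> (S - E)) = node_upoly \<psi> S ^ q * node_upoly \<psi> (S - E)"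
    "\<And>k. S \<noteq> {} \<Longrightarrow> rep u k div \<psi> (u k) = k div sum \<psi> S"
proof -
  have finE: "finite E" and finSE: "finite (S - E)"
    using fin sub by (auto intro: finite_subset)
  obtain xs where xs: "set xs \<subseteq> S - E" "\<And>v. count_list xs v = (if v \<in> S - E then \<psi> v else 0)"
    "length xs = sum \<psi> (S - E)" "(\<Prod>v\<leftarrow>xs. [:- v, 1:]) = node_upoly \<psi> (S - E)"
    using node_list[OF finSE] by blast
  obtain ys where ys: "set ys \<subseteq> E" "\<And>v. count_list ys v = (if v \<in> E then \<psi> v else 0)"
    "length ys = sum \<psi> E" "(\<Prod>v\<leftarrow>ys. [:- v, 1:]) = node_upoly \<psi> E"
    using node_list[OF finE] by blast
  define zs where "zs = xs @ ys"
  define d where "d = sum \<psi> S"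
  define e where "e = sum \<psi> (S - E)"
  \<comment> \<open>For an empty \<open>S\<close> the period is \<open>0\<close> and
    \<open>u k\<close> an unspecified entry; hence the guards \<open>S \<noteq> {}\<close>, while
    the premise \<open>k mod sum \<psi> S < sum \<psi> (S - E)\<close> is then false by
    itself.\<close>
  define u where "u k = zs ! (k mod d)" for k
  have len: "length zs = d"
    using sum.subset_diff[OF sub fin, of \<psi>] by (simp add: zs_def d_def xs ys)
  have ed: "e \<le> d"
    using len by (simp add: zs_def e_def xs)
  have cnt: "count_list zs v = \<psi> v" if "v \<in> S" for v
    using that sub by (auto simp: zs_def xs ys)
  have dpos: "d > 0" if "S \<noteq> {}"
    using that fin pos by (auto simp: d_def intro!: sum_pos)
  have nth: "zs ! j \<in> S" if "j < d" for j
  proof -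
    have "zs ! j \<in> set zs"
      using that len by simp
    then show ?thesis
      using xs(1) ys(1) sub by (auto simp: zs_def)
  qed
  have nthE: "zs ! j \<in> S - E" if "j < e" for j
  proof -
    have "zs ! j \<in> set xs"
      using that by (simp add: zs_def nth_append e_def xs)
    then show ?thesis
      using xs(1) by blast
  qed
  have per: "u (d + l) = u l" for l
    by (simp add: u_def)
  have small: "u l = zs ! l" if "l < d" for l
    using that by (simp add: u_def)
  have newton_d: "newton u d = node_upoly \<psi> S"
  proof -
    have "newton u d = (\<Prod>v\<leftarrow>zs. [:- v, 1:])"
      by (simp add: newton_def prod.list_conv_set_nth len small atLeast0LessThan)
    also have "\<dots> = node_upoly \<psi> S"
      by (simp add: zs_def xs ys prod.subset_diff[OF sub fin, of "\<lambda>v. [:- v, 1:] ^ \<psi> v"])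
    finally show ?thesis .
  qed
  have newton_e: "newton u e = node_upoly \<psi> (S - E)"
  proof -
    have "newton u e = (\<Prod>l<e. [:- (xs ! l), 1:])"
      unfolding newton_def using ed
      by (intro prod.cong) (auto simp: small zs_def nth_append e_def xs)
    also have "\<dots> = (\<Prod>v\<leftarrow>xs. [:- v, 1:])"
      by (simp add: prod.list_conv_set_nth e_def xs(3) atLeast0LessThan)
    finally show ?thesis
      by (simp add: xs)
  qed
  have newton_per: "newton u (q * d + r) = newton u d ^ q * newton u r" for q r
    unfolding newton_def by (rule prod_lessThan_periodic) (simp add: per)
  have rep: "rep u k div \<psi> (u k) = k div d" if "S \<noteq> {}" for k
  proof -
    define v where "v = u k"
    have d: "d > 0"
      using that by (rule dpos)
    then have v: "v \<in> S" "k mod d < d"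
      by (auto simp: v_def u_def nth)
    have card_sum: "card {l. l < n \<and> u l = v} = (\<Sum>l<n. of_bool (u l = v))" for n
      by (simp add: Int_def conj_commute)
    have "rep u k = (\<Sum>l<k div d * d + k mod d. of_bool (u l = v))"
      unfolding rep_def by (simp add: card_sum flip: v_def)
    also have "\<dots> = k div d * (\<Sum>l<d. of_bool (u l = v)) + (\<Sum>l<k mod d. of_bool (u l = v))"
      by (rule sum_lessThan_periodic) (simp add: per)
    also have "(\<Sum>l<d. of_bool (u l = v)) = \<psi> v"
    proof -
      have "(\<Sum>l<d. of_bool (u l = v)) = card {l. l < d \<and> zs ! l = v}"
        unfolding card_sum[symmetric] by (intro arg_cong[of _ _ card]) (auto simp: small)
      also have "\<dots> = count_list zs v"
        by (simp add: count_list_eq_length_filter length_filter_conv_card len eq_commute)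
      finally show ?thesis
        using v cnt by simp
    qed
    finally have eq: "rep u k = k div d * \<psi> v + (\<Sum>l<k mod d. of_bool (u l = v))" .
    \<comment> \<open>The current period contains \<open>v\<close> at position
      \<open>k mod d\<close> too, so strictly fewer than \<open>\<psi> v\<close> occurrences precede
      it there and the quotient is exactly \<open>k div d\<close>.\<close>
    have "u (k mod d) = v"
      by (simp add: v_def u_def)
    then have "(\<Sum>l<k mod d. of_bool (u l = v)) < (\<Sum>l<Suc (k mod d). of_bool (u l = v) :: nat)"
      by simp
    also have "\<dots> \<le> (\<Sum>l<d. of_bool (u l = v))"
      using v(2) by (intro sum_mono2) auto
    also have "\<dots> = \<psi> v"
      by fact
    finally show ?thesis
      using eq by (simp add: v_def)
  qed
  show thesis
  proof (rule that[of u])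
    fix k :: nat
    show "u k \<in> S" if "S \<noteq> {}"
      using dpos[OF that] by (simp add: u_def nth)
    show "u k \<in> S - E" if "k mod sum \<psi> S < sum \<psi> (S - E)"
      using nthE[of "k mod d"] that by (simp add: u_def d_def e_def)
    show "rep u k div \<psi> (u k) = k div sum \<psi> S" if "S \<noteq> {}"
      using rep[OF that] by (simp add: d_def)
  next
    fix q :: nat
    show "newton u (q * sum \<psi> S) = node_upoly \<psi> S ^ q"
      using newton_per[of q 0] newton_d by (simp add: d_def newton_def[of _ 0])
    show "newton u (q * sum \<psi> S + sum \<psi> (S - E)) = node_upoly \<psi> S ^ q * node_upoly \<psi> (S - E)"
      using newton_per[of q e] newton_d newton_e by (simp add: d_def e_def)
  qed
qed

section \<open>Newton expansions in several variables and their coefficients\<close>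

lemma not_zero_divisor_mult:
  "\<not> zero_divisor x \<Longrightarrow> \<not> zero_divisor y \<Longrightarrow> \<not> zero_divisor (x * y)"
  by (auto simp: zero_divisor_def mult.assoc)

lemma not_zero_divisor_prod:
  "(\<And>i. i \<in> A \<Longrightarrow> \<not> zero_divisor (f i)) \<Longrightarrow> \<not> zero_divisor (\<Prod>i\<in>A. f i)"
proof (induction A rule: infinite_finite_induct)
  case (insert i A)
  then show ?case
    by (simp add: not_zero_divisor_mult)
qed (simp_all add: zero_divisor_def)

lemma finite_down_closure:
  assumes "finite A"
  shows "finite (\<Delta> A :: ('n::finite \<Rightarrow> nat) set)"
proof (rule finite_subset)
  show "\<Delta> A \<subseteq> (\<Union>\<alpha>\<in>A. PiE UNIV (\<lambda>i. {..\<alpha> i}))"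
    by (auto simp: down_closure_def le_fun_def)
  show "finite (\<Union>\<alpha>\<in>A. PiE UNIV (\<lambda>i. {..\<alpha> i}))"
    using assms by (auto intro!: finite_PiE)
qed

lemma translate_sum: "translate a (\<Sum>x\<in>A. f x) = (\<Sum>x\<in>A. translate a (f x))"
  by (simp add: translate_def subst_sum)

lemma translate_Const_mult: "translate a (Const c * f) = Const c * translate a f"
  by (simp add: translate_def subst_mult)

lemma monomial_eq_tens: "monomial \<alpha> = tens (\<lambda>i. monom 1 (\<alpha> i))"
  by (simp add: monomial_def tens_def uni_monom)

lemma Const_prod: "Const (\<Prod>i\<in>A. c i) = (\<Prod>i\<in>A. Const (c i))"
  by (induction A rule: infinite_finite_induct) (simp_all add: Const_mult)

lemma Const_sum: "Const (\<Sum>i\<in>A. c i) = (\<Sum>i\<in>A. Const (c i))"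
  by (induction A rule: infinite_finite_induct) (simp_all add: Const_add)

text \<open>Each monomial is expanded variable by variable. Only indices below its exponent occur,
  so all indices lie in \<open>\<Delta>\<close> of the support; the support bound in (2) rests on
  this.\<close>

lemma tens_newton_expansion:
  fixes f :: "('n::finite, 'a::comm_ring_1) mpoly"
  obtains c where "f = (\<Sum>\<beta>\<in>\<Delta> (Poly_Mapping.keys f). Const (c \<beta>) * tens (\<lambda>i. newton (u i) (\<beta> i)))"
proof -
  let ?K = "Poly_Mapping.keys f"
  let ?D = "\<Delta> ?K"
  have fin: "finite ?D"
    by (simp add: finite_down_closure)
  have "\<forall>i m. \<exists>s. monom 1 m = (\<Sum>k\<le>m. smult (s k) (newton (u i) k))"
    using newton_expansion by blast
  then obtain s where s: "monom 1 m = (\<Sum>k\<le>m. smult (s i m k) (newton (u i) k))" for i m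
    by metis
  define b where "b \<alpha> \<beta> = (if \<beta> \<le> \<alpha> then \<Prod>i\<in>UNIV. s i (\<alpha> i) (\<beta> i) else 0)" for \<alpha> \<beta>
  have mon: "monomial \<alpha> = (\<Sum>\<beta>\<in>?D. Const (b \<alpha> \<beta>) * tens (\<lambda>i. newton (u i) (\<beta> i)))" if "\<alpha> \<in> ?K" for \<alpha>
  proof -
    have "monomial \<alpha> = (\<Prod>i\<in>UNIV. \<Sum>k\<in>{..\<alpha> i}. uni i (smult (s i (\<alpha> i) k) (newton (u i) k)))"
      unfolding monomial_eq_tens tens_def uni_sum[symmetric] s[symmetric] ..
    also have "\<dots> = (\<Sum>\<beta>\<in>PiE UNIV (\<lambda>i. {..\<alpha> i}). \<Prod>i\<in>UNIV. uni i (smult (s i (\<alpha> i) (\<beta> i)) (newton (u i) (\<beta> i))))"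
      by (rule prod_sum_PiE) auto
    also have "\<dots> = (\<Sum>\<beta>\<in>?D. Const (b \<alpha> \<beta>) * tens (\<lambda>i. newton (u i) (\<beta> i)))"
      using that fin
      by (intro sum.mono_neutral_cong_left)
        (auto simp: b_def down_closure_def le_fun_def uni_smult prod.distrib tens_def Const_prod)
    finally show ?thesis .
  qed
  have "f = (\<Sum>\<alpha>\<in>?K. Const (Poly_Mapping.lookup f \<alpha>) * monomial \<alpha>)"
    by (rule monomial_expansion) auto
  also have "\<dots> = (\<Sum>\<alpha>\<in>?K. \<Sum>\<beta>\<in>?D. Const (Poly_Mapping.lookup f \<alpha> * b \<alpha> \<beta>) * tens (\<lambda>i. newton (u i) (\<beta> i)))"
    by (intro sum.cong refl) (simp add: mon sum_distrib_left Const_mult mult.assoc)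
  also have "\<dots> = (\<Sum>\<beta>\<in>?D. \<Sum>\<alpha>\<in>?K. Const (Poly_Mapping.lookup f \<alpha> * b \<alpha> \<beta>) * tens (\<lambda>i. newton (u i) (\<beta> i)))"
    by (rule sum.swap)
  also have "\<dots> = (\<Sum>\<beta>\<in>?D. Const (\<Sum>\<alpha>\<in>?K. Poly_Mapping.lookup f \<alpha> * b \<alpha> \<beta>) * tens (\<lambda>i. newton (u i) (\<beta> i)))"
    by (simp add: Const_sum sum_distrib_right)
  finally show thesis
    by (rule that)
qed

text \<open>The functional at \<open>\<beta>\<close> kills every Newton product with index not below \<open>\<beta>\<close> and is regular on
  the one with index \<open>\<beta>\<close>, so the Newton coefficients vanish one after the other, from small to
  large indices.\<close>

lemma newton_coefficients_eq_0:
  fixes c :: "('n::finite \<Rightarrow> nat) \<Rightarrow> 'a::comm_ring_1"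
  assumes fin: "finite D"
    and f: "f = (\<Sum>\<beta>\<in>D. Const (c \<beta>) * tens (\<lambda>i. newton (u i) (\<beta> i)))"
    and down: "\<And>\<beta> \<gamma>. \<beta> \<in> C \<Longrightarrow> \<gamma> \<le> \<beta> \<Longrightarrow> \<gamma> \<in> C"
    and vanish: "\<And>\<beta>. \<beta> \<in> C \<Longrightarrow>
      Poly_Mapping.lookup (translate (\<lambda>i. u i (\<beta> i)) f) (\<lambda>i. rep (u i) (\<beta> i)) = 0"
    and D: "\<And>i. condition_D (range (u i))"
    and "\<beta> \<in> C" "\<beta> \<in> D"
  shows "c \<beta> = 0"
  using assms(6,7)
proof (induction "\<Sum>i\<in>UNIV. \<beta> i" arbitrary: \<beta> rule: less_induct)
  case less
  \<comment> \<open>The functional of index \<open>\<beta>\<close>, evaluated on the Newton product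
    of index \<open>\<gamma>\<close>.\<close>
  define l where "l \<gamma> = (\<Prod>i\<in>UNIV. coeff (pcompose (newton (u i) (\<gamma> i)) [:u i (\<beta> i), 1:]) (rep (u i) (\<beta> i)))" for \<gamma>
  \<comment> \<open>Indices strictly below \<open>\<beta>\<close> stay in \<open>C\<close> and have
    smaller total, so induction applies; any other index exceeds \<open>\<beta>\<close> in some
    coordinate, where the functional vanishes.\<close>
  have zero: "c \<gamma> * l \<gamma> = 0" if \<gamma>: "\<gamma> \<in> D" "\<gamma> \<noteq> \<beta>" for \<gamma>
  proof (cases "\<gamma> \<le> \<beta>")
    case True
    then obtain i where "\<gamma> i < \<beta> i"
      using \<gamma>(2) by (auto simp: le_fun_def fun_eq_iff order_less_le)
    then have "(\<Sum>i\<in>UNIV. \<gamma> i) < (\<Sum>i\<in>UNIV. \<beta> i)"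
      using True by (intro sum_strict_mono_ex1) (auto simp: le_fun_def)
    then show ?thesis
      using less.hyps[of \<gamma>] \<gamma>(1) down[OF less.prems(1) True] by simp
  next
    case False
    then obtain i where "\<beta> i < \<gamma> i"
      by (auto simp: le_fun_def not_le)
    then have "l \<gamma> = 0"
      unfolding l_def using newton_shift_above[of "\<beta> i" "\<gamma> i" "u i"] by (intro prod_zero) auto
    then show ?thesis
      by simp
  qed
  have "0 = (\<Sum>\<gamma>\<in>D. c \<gamma> * l \<gamma>)"
    using vanish[OF less.prems(1)]
    by (simp add: f translate_sum translate_Const_mult translate_tens lookup_sum lookup_Const_mult
        lookup_tens l_def)
  also have "\<dots> = (\<Sum>\<gamma>\<in>{\<beta>}. c \<gamma> * l \<gamma>)"
    using less.prems(2) fin zero by (intro sum.mono_neutral_right) auto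
  finally have "l \<beta> * c \<beta> = 0"
    by (simp add: mult.commute)
  \<comment> \<open>By \<open>newton_shift_diag\<close> this is a product of differences of distinct
    nodes.\<close>
  moreover have "\<not> zero_divisor (l \<beta>)"
    unfolding l_def newton_shift_diag
    using D by (intro not_zero_divisor_prod) (auto simp: condition_D_def)
  ultimately show ?case
    by (auto simp: zero_divisor_def)
qed

text \<open>Raise one coordinate at a time; there is room as long as the total is short of that of
  \<open>q\<close>.\<close>

lemma exists_below_with_sum:
  assumes "t \<le> (\<Sum>i\<in>UNIV. q i)"
  obtains \<alpha> :: "'n::finite \<Rightarrow> nat" where "\<alpha> \<le> q" "(\<Sum>i\<in>UNIV. \<alpha> i) = t"
proof -
  have "\<exists>\<alpha>\<le>q. (\<Sum>i\<in>UNIV. \<alpha> i) = t"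
    using assms
  proof (induction t)
    case 0
    show ?case
      by (rule exI[of _ "\<lambda>_. 0"]) (simp add: le_fun_def)
  next
    case (Suc t)
    then obtain \<alpha> where \<alpha>: "\<alpha> \<le> q" "(\<Sum>i\<in>UNIV. \<alpha> i) = t"
      by auto
    have "\<exists>i. \<alpha> i < q i"
    proof (rule ccontr)
      assume "\<nexists>i. \<alpha> i < q i"
      then have "(\<Sum>i\<in>UNIV. q i) \<le> (\<Sum>i\<in>UNIV. \<alpha> i)"
        by (intro sum_mono) (auto simp: not_less)
      then show False
        using \<alpha> Suc.prems by simp
    qed
    then obtain i where i: "\<alpha> i < q i"
      by blast
    have "(\<Sum>j\<in>UNIV. (\<alpha>(i := Suc (\<alpha> i))) j) = (\<Sum>j\<in>UNIV. \<alpha> j + (if j = i then 1 else 0))"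
      by (intro sum.cong) auto
    then have "(\<Sum>j\<in>UNIV. (\<alpha>(i := Suc (\<alpha> i))) j) = Suc t"
      by (simp add: sum.distrib \<alpha>)
    moreover have "\<alpha>(i := Suc (\<alpha> i)) \<le> q"
      using \<alpha>(1) i by (auto simp: le_fun_def)
    ultimately show ?case
      by blast
  qed
  then show thesis
    using that by blast
qed

section \<open>Degrees and factors of the node polynomials\<close>

lemma node_poly_eq_uni:
  fixes \<psi> :: "'n::finite \<Rightarrow> 'a::comm_ring_1 \<Rightarrow> nat"
  shows "node_poly \<psi> T k = uni k (node_upoly (\<psi> k) (T k))"
proof -
  have "uni k [:- u, 1:] = Var k - Const u" for u :: 'a
    by (simp add: uni_pCons Const_uminus)
  then show ?thesis
    by (simp add: node_poly_def uni_prod uni_power)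
qed

lemma finite_index_set: "finite (index_set t :: ('n::finite \<Rightarrow> nat) set)"
proof (rule finite_subset)
  show "index_set t \<subseteq> PiE UNIV (\<lambda>_::'n. {..t})"
  proof
    fix \<alpha> :: "'n \<Rightarrow> nat"
    assume "\<alpha> \<in> index_set t"
    then have "sum \<alpha> UNIV \<le> t"
      by (auto simp: index_set_def)
    moreover have "\<alpha> i \<le> sum \<alpha> UNIV" for i
      by (rule member_le_sum) auto
    ultimately show "\<alpha> \<in> PiE UNIV (\<lambda>_. {..t})"
      using order_trans by (auto simp: PiE_iff)
  qed
qed (auto intro: finite_PiE)

text \<open>Along a list of the nodes with multiplicity the product is a Newton polynomial, whose
  degree bound and top coefficient are known.\<close>

lemma degree_node_upoly_le: "finite T \<Longrightarrow> degree (node_upoly m T) \<le> sum m T"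
  and coeff_node_upoly: "finite T \<Longrightarrow> coeff (node_upoly m T) (sum m T) = 1"
proof -
  have "degree (node_upoly m T) \<le> sum m T \<and> coeff (node_upoly m T) (sum m T) = 1" if fin: "finite T"
  proof -
    obtain xs where xs: "length xs = sum m T" "(\<Prod>v\<leftarrow>xs. [:- v, 1:]) = node_upoly m T"
      using node_list[OF fin, of m] by metis
    have "node_upoly m T = newton (nth xs) (sum m T)"
      by (simp add: newton_def prod.list_conv_set_nth atLeast0LessThan flip: xs)
    then show ?thesis
      by (simp add: degree_newton_le)
  qed
  then show "finite T \<Longrightarrow> degree (node_upoly m T) \<le> sum m T"
    and "finite T \<Longrightarrow> coeff (node_upoly m T) (sum m T) = 1"
    by auto
qed

text \<open>One factor of the product can be dropped: since \<open>c * (X - a) = c * (X - b)\<close>, a factor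
  belonging to \<open>a\<close> replaces the missing one at \<open>b\<close>.\<close>

lemma dropped_node:
  fixes c :: "'a::comm_ring_1"
  assumes fin: "finite T" and ab: "a \<in> T" "b \<in> T" "a \<noteq> b" and m: "m a > 0" "m b > 0"
    and c: "(b - a) * c = 0"
  obtains P where "degree P \<le> sum m T - 1" "coeff P (sum m T - 1) = c"
    "\<And>v. v \<in> T \<Longrightarrow> [:- v, 1:] ^ m v dvd P"
proof -
  define m' where "m' = m(b := m b - 1)"
  define P where "P = smult c (node_upoly m' T)"
  have "sum m T = m b + sum m (T - {b})" "sum m' T = m' b + sum m' (T - {b})"
    using fin ab(2) by (simp_all add: sum.remove)
  moreover have "sum m' (T - {b}) = sum m (T - {b})"
    by (intro sum.cong) (auto simp: m'_def)
  ultimately have sum: "sum m T - 1 = sum m' T"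
    using m by (simp add: m'_def)
  show thesis
  proof (rule that[of P])
    show "degree P \<le> sum m T - 1"
      unfolding sum P_def using degree_smult_le degree_node_upoly_le[OF fin] by (rule order_trans)
    show "coeff P (sum m T - 1) = c"
      unfolding sum P_def by (simp add: coeff_node_upoly[OF fin])
    \<comment> \<open>Each power is checked in a factorization of its own: divisibility is claimed
      for the single powers, not for their product.\<close>
    show "[:- v, 1:] ^ m v dvd P" if v: "v \<in> T" for v
    proof (cases "v = b")
      case False
      have "[:- v, 1:] ^ m' v dvd node_upoly m' T"
        using fin v by (intro dvd_prodI)
      then show ?thesis
        using False by (simp add: P_def m'_def dvd_smult)
    next
      case True
      let ?R = "node_upoly m' (T - {b} - {a})"
      have "node_upoly m' T = [:- b, 1:] ^ m' b * ([:- a, 1:] ^ m' a * ?R)"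
        using fin ab by (simp add: prod.remove[of T b] prod.remove[of "T - {b}" a])
      also have "[:- a, 1:] ^ m' a = [:- a, 1:] * [:- a, 1:] ^ (m a - 1)"
        using ab m by (simp add: m'_def flip: power_Suc)
      finally have "P = smult c [:- a, 1:] * ([:- b, 1:] ^ m' b * ([:- a, 1:] ^ (m a - 1) * ?R))"
        unfolding P_def by (simp only: mult_smult_left ac_simps)
      also have "smult c [:- a, 1:] = smult c [:- b, 1:]"
        using c by (simp add: algebra_simps)
      also have "\<dots> * ([:- b, 1:] ^ m' b * ([:- a, 1:] ^ (m a - 1) * ?R)) =
          smult c ([:- b, 1:] * [:- b, 1:] ^ m' b * ([:- a, 1:] ^ (m a - 1) * ?R))"
        by (simp only: mult_smult_left mult.assoc)
      also have "[:- b, 1:] * [:- b, 1:] ^ m' b = [:- b, 1:] ^ m b"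
        using m by (simp add: m'_def flip: power_Suc)
      finally show ?thesis
        using True by (simp add: dvd_smult)
    qed
  qed
qed

subsection \<open>The ideal and its basis\<close>

locale nodes =
  fixes S E :: "'n::finite \<Rightarrow> 'a::comm_ring_1 set"
    and \<psi> :: "'n \<Rightarrow> 'a \<Rightarrow> nat"
    and t :: nat
  assumes finite_S: "finite (S k)"
    and psi_pos: "u \<in> S k \<Longrightarrow> \<psi> k u > 0"
    and E_sub: "E k \<subseteq> S k"
    and t_pos: "t > 0"
begin

abbreviation dS :: "'n \<Rightarrow> nat" where "dS i \<equiv> sum (\<psi> i) (S i)"
abbreviation dH :: "'n \<Rightarrow> nat" where "dH i \<equiv> sum (\<psi> i) (S i - E i)"
abbreviation G :: "'n \<Rightarrow> 'a poly" where "G i \<equiv> node_upoly (\<psi> i) (S i)"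
abbreviation H :: "'n \<Rightarrow> 'a poly" where "H i \<equiv> node_upoly (\<psi> i) (S i - E i)"

text \<open>The part of \<phi>(\<alpha>) in the variable \<open>i\<close>. As in
  \<open>basis_poly\<close>, only \<open>\<alpha>\<close> in \<open>index_set t\<close> matters, so
  a total other than \<open>t\<close> means \<open>t - 1\<close>.\<close>

definition factor :: "('n \<Rightarrow> nat) \<Rightarrow> 'n \<Rightarrow> 'a poly" where
  "factor \<alpha> i = G i ^ \<alpha> i * (if sum \<alpha> UNIV = t then 1 else H i)"

text \<open>This is \<theta>(\<alpha>), as \<open>greatest_exponent_basis\<close> confirms.\<close>

definition theta :: "('n \<Rightarrow> nat) \<Rightarrow> 'n \<Rightarrow> nat" where
  "theta \<alpha> i = \<alpha> i * dS i + (if sum \<alpha> UNIV = t then 0 else dH i)"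

lemma basis_poly_eq_tens: "basis_poly \<psi> S E t \<alpha> = tens (factor \<alpha>)"
  by (simp add: basis_poly_def factor_def[abs_def] tens_def node_poly_eq_uni uni_mult uni_power prod.distrib)

lemma obtain_sequences:
  obtains u where
    "\<And>i k. S i \<noteq> {} \<Longrightarrow> u i k \<in> S i"
    "\<And>i k. k mod dS i < dH i \<Longrightarrow> u i k \<in> S i - E i"
    "\<And>i k. S i \<noteq> {} \<Longrightarrow> rep (u i) k div \<psi> i (u i k) = k div dS i"
    "\<And>\<alpha> i. factor \<alpha> i = newton (u i) (theta \<alpha> i)"
proof -
  define P where "P i v \<longleftrightarrow> (\<forall>k. S i \<noteq> {} \<longrightarrow> v k \<in> S i) \<and> (\<forall>k. k mod dS i < dH i \<longrightarrow> v k \<in> S i - E i) \<and>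
    (\<forall>k. S i \<noteq> {} \<longrightarrow> rep v k div \<psi> i (v k) = k div dS i) \<and>
    (\<forall>\<alpha>. factor \<alpha> i = newton v (theta \<alpha> i))" for i and v :: "nat \<Rightarrow> 'a"
  have "\<exists>v. P i v" for i
  proof -
    obtain v where "\<And>k. S i \<noteq> {} \<Longrightarrow> v k \<in> S i"
      "\<And>k. k mod dS i < dH i \<Longrightarrow> v k \<in> S i - E i"
      "\<And>q. newton v (q * dS i) = G i ^ q"
      "\<And>q. newton v (q * dS i + dH i) = G i ^ q * H i"
      "\<And>k. S i \<noteq> {} \<Longrightarrow> rep v k div \<psi> i (v k) = k div dS i"
      by (rule node_sequence[of "S i" "\<psi> i" "E i", OF finite_S psi_pos E_sub])
        (assumption, rule that)
    then have "P i v"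
      by (simp add: P_def factor_def theta_def)
    then show ?thesis
      by blast
  qed
  then obtain u where "P i (u i)" for i
    by metis
  then show thesis
    by (intro that[of u]) (auto simp: P_def)
qed

lemma degree_factor_le: "degree (factor \<alpha> i) \<le> theta \<alpha> i"
  and coeff_factor: "coeff (factor \<alpha> i) (theta \<alpha> i) = 1"
proof -
  obtain u where "\<And>\<alpha> i. factor \<alpha> i = newton (u i) (theta \<alpha> i)"
    using obtain_sequences by metis
  then show "degree (factor \<alpha> i) \<le> theta \<alpha> i" "coeff (factor \<alpha> i) (theta \<alpha> i) = 1"
    by (simp_all add: degree_newton_le)
qed

lemma greatest_exponent_basis: "greatest_exponent (basis_poly \<psi> S E t \<alpha>) (theta \<alpha>)"
  by (simp add: basis_poly_eq_tens greatest_exponent_tens degree_factor_le coeff_factor)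

lemma monic_basis: "Defs.monic (basis_poly \<psi> S E t \<alpha>)"
proof -
  have "Poly_Mapping.lookup (basis_poly \<psi> S E t \<alpha>) (theta \<alpha>) = 1"
    by (simp add: basis_poly_eq_tens lookup_tens coeff_factor)
  then show ?thesis
    unfolding Defs.monic_def using greatest_exponent_basis by blast
qed

lemma vanishing_ideal_iff:
  "f \<in> vanishing_ideal \<psi> S E t \<longleftrightarrow>
    (\<forall>a \<beta>. a \<in> Pi UNIV S \<longrightarrow> a \<notin> Pi UNIV E \<longrightarrow> (\<Sum>i\<in>UNIV. \<beta> i div \<psi> i (a i)) < t \<longrightarrow>
      Poly_Mapping.lookup (translate a f) \<beta> = 0) \<and>
    (\<forall>a \<beta>. a \<in> Pi UNIV E \<longrightarrow> (\<Sum>i\<in>UNIV. \<beta> i div \<psi> i (a i)) < t - 1 \<longrightarrow>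
      Poly_Mapping.lookup (translate a f) \<beta> = 0)"
proof -
  \<comment> \<open>At \<open>t = 1\<close> the truncated \<open>t - 1\<close> is \<open>0\<close>,
    so the condition over \<open>E\<close> is vacuous, as it is over the integers.\<close>
  have "int m \<le> int t - 1 \<longleftrightarrow> m < t" "int m \<le> int t - 2 \<longleftrightarrow> m < t - 1" for m
    by auto
  then show ?thesis
    unfolding vanishing_ideal_def by (simp only: mem_Collect_eq) blast
qed

text \<open>At each point the exponents required to be absent form a set closed downwards, and every
  exponent of a translated product lies above one of the second factor.\<close>

lemma is_ideal_vanishing_ideal: "is_ideal (vanishing_ideal \<psi> S E t)"
proof -
  have mult: "Poly_Mapping.lookup (translate a (p * f)) \<beta> = 0"
    if vanish: "\<forall>\<beta>. (\<Sum>i\<in>UNIV. \<beta> i div \<psi> i (a i)) < r \<longrightarrow> Poly_Mapping.lookup (translate a f) \<beta> = 0"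
      and less: "(\<Sum>i\<in>UNIV. \<beta> i div \<psi> i (a i)) < r" for a p f \<beta> r
  proof (rule ccontr)
    assume "Poly_Mapping.lookup (translate a (p * f)) \<beta> \<noteq> 0"
    then have "\<beta> \<in> Poly_Mapping.keys (translate a p * translate a f)"
      by (simp add: in_keys_iff translate_def subst_mult)
    then obtain \<gamma> \<delta> where \<beta>: "\<beta> = \<gamma> + \<delta>" and \<delta>: "\<delta> \<in> Poly_Mapping.keys (translate a f)"
      using keys_mult[of "translate a p" "translate a f"] by auto
    have "(\<Sum>i\<in>UNIV. \<delta> i div \<psi> i (a i)) \<le>  (\<Sum>i\<in>UNIV. \<beta> i div \<psi> i (a i))"
      by (intro sum_mono div_le_mono) (simp add: \<beta>)
    then have "Poly_Mapping.lookup (translate a f) \<delta> = 0"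
      using vanish less order_le_less_trans by blast
    then show False
      using \<delta> by (simp add: in_keys_iff)
  qed
  have add: "translate a (f + g) = translate a f + translate a g" "translate a 0 = 0" for a f g
    by (simp_all add: translate_def subst_add)
  show ?thesis
    unfolding is_ideal_def
  proof (intro conjI ballI allI)
    show "0 \<in> vanishing_ideal \<psi> S E t"
      by (simp add: vanishing_ideal_iff add)
  next
    fix f g assume "f \<in> vanishing_ideal \<psi> S E t" "g \<in> vanishing_ideal \<psi> S E t"
    then show "f + g \<in> vanishing_ideal \<psi> S E t"
      by (simp add: vanishing_ideal_iff add lookup_add)
  next
    fix p f assume "f \<in> vanishing_ideal \<psi> S E t"
    then show "p * f \<in> vanishing_ideal \<psi> S E t"
      unfolding vanishing_ideal_iff using mult by blast
  qed
qed

text \<open>The weight \<open>w i v\<close> is an order of vanishing counted in units of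
  \<open>\<psi> i v\<close>: every exponent of the translate by \<open>a\<close> has floor sum at
  least the sum of the \<open>w i (a i)\<close>.\<close>

lemma tens_in_vanishing_ideal:
  assumes dvd: "\<And>i v. v \<in> S i \<Longrightarrow> [:- v, 1:] ^ (\<psi> i v * w i v) dvd p i"
    and S: "\<And>a. a \<in> Pi UNIV S \<Longrightarrow> a \<notin> Pi UNIV E \<Longrightarrow> t \<le> (\<Sum>i\<in>UNIV. w i (a i))"
    and E: "\<And>a. a \<in> Pi UNIV E \<Longrightarrow> t \<le> Suc (\<Sum>i\<in>UNIV. w i (a i))"
  shows "tens p \<in> vanishing_ideal \<psi> S E t"
proof -
  have key: "(\<Sum>i\<in>UNIV. w i (a i)) \<le> (\<Sum>i\<in>UNIV. \<beta> i div \<psi> i (a i))"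
    if a: "a \<in> Pi UNIV S" and "Poly_Mapping.lookup (translate a (tens p)) \<beta> \<noteq> 0" for a \<beta>
  proof (rule sum_mono)
    fix i
    have "coeff (pcompose (p i) [:a i, 1:]) (\<beta> i) \<noteq> 0"
      using that(2) prod_zero[of UNIV "\<lambda>i. coeff (pcompose (p i) [:a i, 1:]) (\<beta> i)"]
      by (auto simp: translate_tens lookup_tens)
    moreover have "a i \<in> S i"
      using a by auto
    ultimately have "\<psi> i (a i) * w i (a i) \<le> \<beta> i"
      using pcompose_shift_eq_0[OF dvd[of "a i" i]] by (meson not_le)
    then show "w i (a i) \<le> \<beta> i div \<psi> i (a i)"
      using psi_pos[OF \<open>a i \<in> S i\<close>] by (simp add: less_eq_div_iff_mult_less_eq mult.commute)
  qed
  have ES: "a \<in> Pi UNIV S" if "a \<in> Pi UNIV E" for a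
    using that E_sub by auto
  show ?thesis
    unfolding vanishing_ideal_iff
  proof (intro conjI allI impI)
    fix a \<beta>
    assume "a \<in> Pi UNIV S" "a \<notin> Pi UNIV E" "(\<Sum>i\<in>UNIV. \<beta> i div \<psi> i (a i)) < t"
    then show "Poly_Mapping.lookup (translate a (tens p)) \<beta> = 0"
      using key[of a \<beta>] S[of a] by linarith
  next
    fix a \<beta>
    assume "a \<in> Pi UNIV E" "(\<Sum>i\<in>UNIV. \<beta> i div \<psi> i (a i)) < t - 1"
    then show "Poly_Mapping.lookup (translate a (tens p)) \<beta> = 0"
      using key[OF ES, of a \<beta>] E[of a] by linarith
  qed
qed

lemma basis_in_vanishing_ideal:
  assumes "\<alpha> \<in> index_set t"
  shows "basis_poly \<psi> S E t \<alpha> \<in> vanishing_ideal \<psi> S E t"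
  unfolding basis_poly_eq_tens
proof (rule tens_in_vanishing_ideal)
  \<comment> \<open>\<open>G i ^ \<alpha> i\<close> contributes \<open>\<alpha> i\<close> at every
    node; \<open>H i\<close>, present only for total \<open>t - 1\<close>, adds one outside
    \<open>E i\<close>.\<close>
  let ?w = "\<lambda>i v. \<alpha> i + (if sum \<alpha> UNIV = t \<or> v \<in> E i then 0 else 1)"
  show "[:- v, 1:] ^ (\<psi> i v * ?w i v) dvd factor \<alpha> i" if "v \<in> S i" for i v
  proof -
    have "[:- v, 1:] ^ \<psi> i v dvd G i"
      using that finite_S by (intro dvd_prodI) auto
    then have "[:- v, 1:] ^ (\<psi> i v * \<alpha> i) dvd G i ^ \<alpha> i"
      by (simp add: power_mult dvd_power_same)
    moreover have "[:- v, 1:] ^ \<psi> i v dvd H i" if "v \<notin> E i"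
      using that \<open>v \<in> S i\<close> finite_S by (intro dvd_prodI) auto
    ultimately show ?thesis
      by (auto simp: factor_def power_add mult.commute[of "_ ^ \<psi> i v"] mult_dvd_mono)
  qed
  show "t \<le> (\<Sum>i\<in>UNIV. ?w i (a i))" if a: "a \<in> Pi UNIV S" "a \<notin> Pi UNIV E" for a
  proof (cases "sum \<alpha> UNIV = t")
    case False
    then have sum: "sum \<alpha> UNIV = t - 1"
      using assms by (auto simp: index_set_def)
    \<comment> \<open>A coordinate outside \<open>E\<close> supplies the unit that
      \<open>t - 1\<close> lacks.\<close>
    obtain i where "a i \<notin> E i"
      using a(2) by auto
    then have "sum \<alpha> UNIV < (\<Sum>i\<in>UNIV. ?w i (a i))"
      using False by (intro sum_strict_mono_ex1) auto
    then show ?thesis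
      using sum by simp
  qed simp
  show "t \<le> Suc (\<Sum>i\<in>UNIV. ?w i (a i))" for a
  proof -
    have "sum \<alpha> UNIV \<le> (\<Sum>i\<in>UNIV. ?w i (a i))"
      by (intro sum_mono) simp
    then show ?thesis
      using assms by (auto simp: index_set_def)
  qed
qed

section \<open>Groebner basis and representation under Condition (D)\<close>

lemma nodes_nonempty:
  assumes \<beta>: "\<forall>\<alpha>\<in>index_set t. \<not> theta \<alpha> \<le> \<beta>"
  shows "S i \<noteq> {}"
proof
  assume i: "S i = {}"
  \<comment> \<open>Without nodes in the variable \<open>i\<close>, \<open>theta \<alpha>\<close> is
    zero for this \<open>\<alpha>\<close> and so lies below every \<open>\<beta>\<close>.\<close>
  define \<alpha> where "\<alpha> j = (if j = i then t else 0)" for j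
  have "sum \<alpha> UNIV = t"
    by (simp add: \<alpha>_def)
  then have "\<alpha> \<in> index_set t" "theta \<alpha> \<le> \<beta>"
    by (auto simp: index_set_def theta_def le_fun_def \<alpha>_def i)
  then show False
    using \<beta> by blast
qed

text \<open>By \<open>rep\<close>, the floor sum of the tested exponent is the sum of the
  \<open>\<beta> i div dS i\<close>. Were it too large for the vanishing conditions, some
  \<open>theta \<alpha>\<close> would lie below \<open>\<beta>\<close>.\<close>

lemma newton_functional_vanishes:
  assumes f: "f \<in> vanishing_ideal \<psi> S E t"
    and \<beta>: "\<forall>\<alpha>\<in>index_set t. \<not> theta \<alpha> \<le> \<beta>"
    and S: "\<And>i k. S i \<noteq> {} \<Longrightarrow> u i k \<in> S i"
    and H: "\<And>i k. k mod dS i < dH i \<Longrightarrow> u i k \<in> S i - E i"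
    and rep: "\<And>i k. S i \<noteq> {} \<Longrightarrow> rep (u i) k div \<psi> i (u i k) = k div dS i"
  shows "Poly_Mapping.lookup (translate (\<lambda>i. u i (\<beta> i)) f) (\<lambda>i. rep (u i) (\<beta> i)) = 0"
proof -
  have nonempty: "S i \<noteq> {}" for i
    using \<beta> by (rule nodes_nonempty)
  define q where "q i = \<beta> i div dS i" for i
  have sum: "(\<Sum>i\<in>UNIV. rep (u i) (\<beta> i) div \<psi> i (u i (\<beta> i))) = sum q UNIV"
    by (simp add: rep[OF nonempty] q_def)
  have a: "(\<lambda>i. u i (\<beta> i)) \<in> Pi UNIV S"
    using S[OF nonempty] by auto
  have less: "sum q UNIV < t"
  proof (rule ccontr)
    assume "\<not> sum q UNIV < t"
    then obtain \<alpha> where \<alpha>: "\<alpha> \<le> q" "sum \<alpha> UNIV = t"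
      using exists_below_with_sum[of t q] by auto
    have "\<alpha> i * dS i \<le> \<beta> i" for i
    proof -
      have "\<alpha> i * dS i \<le> q i * dS i"
        using \<alpha>(1) by (simp add: le_fun_def)
      also have "\<dots> \<le> \<beta> i"
        by (simp add: q_def)
      finally show ?thesis .
    qed
    then have "theta \<alpha> \<le> \<beta>" "\<alpha> \<in> index_set t"
      using \<alpha>(2) by (auto simp: theta_def le_fun_def index_set_def)
    then show False
      using \<beta> by blast
  qed
  have less_E: "sum q UNIV < t - 1" if E: "(\<lambda>i. u i (\<beta> i)) \<in> Pi UNIV E"
  proof (rule ccontr)
    assume "\<not> sum q UNIV < t - 1"
    then have "sum q UNIV = t - 1"
      using less by simp
    \<comment> \<open>Now \<open>q\<close> is itself an index of total \<open>t - 1\<close>. Since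
      \<open>theta q\<close> is not below \<open>\<beta>\<close>, some remainder is less than
      \<open>dH i\<close>, and such a position of the sequence carries a node outside
      \<open>E i\<close>.\<close>
    then have q: "q \<in> index_set t" "sum q UNIV \<noteq> t"
      using t_pos by (auto simp: index_set_def)
    then obtain i where "\<beta> i < q i * dS i + dH i"
      using \<beta> by (auto simp: theta_def le_fun_def not_le)
    then have "\<beta> i mod dS i < dH i"
      using div_mult_mod_eq[of "\<beta> i" "dS i"] by (simp add: q_def)
    then show False
      using H[of "\<beta> i" i] E by auto
  qed
  show ?thesis
  proof (cases "(\<lambda>i. u i (\<beta> i)) \<in> Pi UNIV E")
    case True
    then show ?thesis
      using f less_E sum unfolding vanishing_ideal_iff by simp
  next
    case False
    then show ?thesis
      using f a less sum unfolding vanishing_ideal_iff by simp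
  qed
qed

text \<open>\<open>A\<close> collects the Newton indices above some \<open>theta \<alpha>\<close>:
  its elements prove the Groebner property, and dividing each of their Newton products by a basis
  polynomial gives the cofactors \<open>p\<close>.\<close>

lemma expansion:
  assumes D: "\<And>k. condition_D (S k)" and f: "f \<in> vanishing_ideal \<psi> S E t"
  obtains p A where
    "A \<subseteq> \<Delta> (Poly_Mapping.keys f)" "f \<noteq> 0 \<Longrightarrow> A \<noteq> {}" "\<And>\<beta>. \<beta> \<in> A \<Longrightarrow> \<exists>\<alpha>\<in>index_set t. theta \<alpha> \<le> \<beta>"
    "f = (\<Sum>\<alpha>\<in>index_set t. p \<alpha> * basis_poly \<psi> S E t \<alpha>)"
    "\<And>\<alpha> \<kappa>. \<kappa> \<in> Poly_Mapping.keys (p \<alpha>) \<Longrightarrow> \<kappa> + theta \<alpha> \<in> \<Delta> (Poly_Mapping.keys f)"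
proof -
  let ?D = "\<Delta> (Poly_Mapping.keys f)"
  let ?C = "{\<beta>. \<forall>\<alpha>\<in>index_set t. \<not> theta \<alpha> \<le> \<beta>}"
  have finD: "finite ?D"
    by (simp add: finite_down_closure)
  have downD: "\<gamma> \<in> ?D" if "\<beta> \<in> ?D" "\<gamma> \<le> \<beta>" for \<beta> \<gamma>
    using that order_trans by (fastforce simp: down_closure_def)
  obtain u where u: "\<And>i k. S i \<noteq> {} \<Longrightarrow> u i k \<in> S i"
    "\<And>i k. k mod dS i < dH i \<Longrightarrow> u i k \<in> S i - E i"
    "\<And>i k. S i \<noteq> {} \<Longrightarrow> rep (u i) k div \<psi> i (u i k) = k div dS i"
    "\<And>\<alpha> i. factor \<alpha> i = newton (u i) (theta \<alpha> i)"
    by (rule obtain_sequences) (rule that)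
  obtain c where c: "f = (\<Sum>\<beta>\<in>?D. Const (c \<beta>) * tens (\<lambda>i. newton (u i) (\<beta> i)))"
    by (rule tens_newton_expansion)
  have zero: "c \<beta> = 0" if \<beta>: "\<beta> \<in> ?C" "\<beta> \<in> ?D" for \<beta>
  proof (rule newton_coefficients_eq_0[OF finD c _ _ _ \<beta>])
    show "\<gamma> \<in> ?C" if "\<beta> \<in> ?C" "\<gamma> \<le> \<beta>" for \<beta> \<gamma>
      using that order_trans by blast
    show "Poly_Mapping.lookup (translate (\<lambda>i. u i (\<beta> i)) f) (\<lambda>i. rep (u i) (\<beta> i)) = 0"
      if "\<beta> \<in> ?C" for \<beta>
      using newton_functional_vanishes[OF f _ u(1-3)] that by blast
    show "condition_D (range (u i))" for i
    proof -
      have "S i \<noteq> {}"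
        using \<beta>(1) by (intro nodes_nonempty) blast
      then show ?thesis
        using D[of i] u(1)[of i] by (auto simp: condition_D_def)
    qed
  qed
  define A where "A = ?D - ?C"
  have fA: "f = (\<Sum>\<beta>\<in>A. Const (c \<beta>) * tens (\<lambda>i. newton (u i) (\<beta> i)))"
    unfolding A_def by (subst c, rule sum.mono_neutral_right) (use finD zero in auto)
  have "\<forall>\<beta>. \<exists>\<alpha>. \<beta> \<in> A \<longrightarrow> \<alpha> \<in> index_set t \<and> theta \<alpha> \<le> \<beta>"
    by (auto simp: A_def)
  then obtain r where r: "\<beta> \<in> A \<Longrightarrow> r \<beta> \<in> index_set t" "\<beta> \<in> A \<Longrightarrow> theta (r \<beta>) \<le> \<beta>" for \<beta>
    by metis
  \<comment> \<open>The cofactor takes the factors from position \<open>theta (r \<beta>) i\<close>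
    on; the earlier ones form the basis polynomial.\<close>
  define rest where "rest \<beta> i = newton (\<lambda>l. u i (theta (r \<beta>) i + l)) (\<beta> i - theta (r \<beta>) i)" for \<beta> i
  have rest: "tens (\<lambda>i. newton (u i) (\<beta> i)) = tens (rest \<beta>) * basis_poly \<psi> S E t (r \<beta>)" if "\<beta> \<in> A" for \<beta>
  proof -
    have "newton (u i) (\<beta> i) = rest \<beta> i * factor (r \<beta>) i" for i
      using newton_add[of "u i" "theta (r \<beta>) i" "\<beta> i - theta (r \<beta>) i"] r(2)[OF that]
      by (simp add: rest_def u(4) le_fun_def mult.commute)
    then show ?thesis
      by (simp add: basis_poly_eq_tens tens_mult)
  qed
  define p where "p \<alpha> = (\<Sum>\<beta>\<in>{\<beta> \<in> A. r \<beta> = \<alpha>}. Const (c \<beta>) * tens (rest \<beta>))" for \<alpha>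
  have finA: "finite A"
    using finD by (simp add: A_def)
  show thesis
  proof (rule that[of A p])
    show "A \<subseteq> ?D"
      by (auto simp: A_def)
    show "f \<noteq> 0 \<Longrightarrow> A \<noteq> {}"
      using fA by auto
    show "\<exists>\<alpha>\<in>index_set t. theta \<alpha> \<le> \<beta>" if "\<beta> \<in> A" for \<beta>
      using r that by blast
    have "f = (\<Sum>\<beta>\<in>A. Const (c \<beta>) * tens (rest \<beta>) * basis_poly \<psi> S E t (r \<beta>))"
      by (subst fA) (simp add: rest mult.assoc)
    also have "\<dots> = (\<Sum>\<alpha>\<in>index_set t. \<Sum>\<beta>\<in>{\<beta> \<in> A. r \<beta> = \<alpha>}. Const (c \<beta>) * tens (rest \<beta>) * basis_poly \<psi> S E t (r \<beta>))"
      using r by (intro sum.group[symmetric] finA finite_index_set) auto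
    also have "\<dots> = (\<Sum>\<alpha>\<in>index_set t. p \<alpha> * basis_poly \<psi> S E t \<alpha>)"
      by (simp add: p_def sum_distrib_right)
    finally show "f = (\<Sum>\<alpha>\<in>index_set t. p \<alpha> * basis_poly \<psi> S E t \<alpha>)" .
    show "\<kappa> + theta \<alpha> \<in> ?D" if "\<kappa> \<in> Poly_Mapping.keys (p \<alpha>)" for \<alpha> \<kappa>
    proof -
      have "(\<Sum>\<beta>\<in>{\<beta> \<in> A. r \<beta> = \<alpha>}. c \<beta> * Poly_Mapping.lookup (tens (rest \<beta>)) \<kappa>) \<noteq> 0"
        using that by (simp add: in_keys_iff p_def lookup_sum lookup_Const_mult)
      then obtain \<beta> where \<beta>: "\<beta> \<in> A" "r \<beta> = \<alpha>" "c \<beta> * Poly_Mapping.lookup (tens (rest \<beta>)) \<kappa> \<noteq> 0"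
        by (auto elim: sum.not_neutral_contains_not_neutral)
      then have "\<kappa> \<in> Poly_Mapping.keys (tens (rest \<beta>))"
        by (auto simp: in_keys_iff)
      then have "\<kappa> \<le> (\<lambda>i. \<beta> i - theta \<alpha> i)"
        by (rule keys_tens_le[rotated]) (simp add: rest_def \<beta>(2) degree_newton_le)
      then have "\<kappa> + theta \<alpha> \<le> \<beta>"
        using r(2)[OF \<beta>(1)] \<beta>(2) by (simp add: le_fun_def) (meson le_diff_conv2)
      then show ?thesis
        using downD \<beta>(1) by (auto simp: A_def)
    qed
  qed
qed

lemma groebner_basis:
  assumes "\<And>k. condition_D (S k)"
  shows "groebner_basis (index_set t) (basis_poly \<psi> S E t) (vanishing_ideal \<psi> S E t)"
  unfolding groebner_basis_def
proof (intro conjI ballI)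
  fix \<tau> assume "\<tau> \<in> vanishing_ideal \<psi> S E t - {0}"
  then obtain A where A: "A \<subseteq> \<Delta> (Poly_Mapping.keys \<tau>)" "A \<noteq> {}" "\<And>\<beta>. \<beta> \<in> A \<Longrightarrow> \<exists>\<alpha>\<in>index_set t. theta \<alpha> \<le> \<beta>"
    using expansion[OF assms, of \<tau>] by (metis DiffE singletonI)
  then obtain \<alpha> \<beta> r where "\<alpha> \<in> Poly_Mapping.keys \<tau>" "\<beta> \<le> \<alpha>" "r \<in> index_set t" "theta r \<le> \<beta>"
    by (fastforce simp: down_closure_def)
  then show "\<exists>\<alpha>\<in>Poly_Mapping.keys \<tau>. \<exists>r\<in>index_set t. \<exists>\<theta>. greatest_exponent (basis_poly \<psi> S E t r) \<theta> \<and> \<theta> \<le> \<alpha>"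
    using greatest_exponent_basis order_trans by blast
qed (auto simp: finite_index_set is_ideal_vanishing_ideal monic_basis basis_in_vanishing_ideal)

text \<open>Exponents of \<open>basis_poly\<close> lie below \<open>theta \<alpha>\<close>, so the
  bound on \<open>\<kappa> + theta \<alpha>\<close> passes to the whole sum of supports.\<close>

lemma representation:
  assumes "\<And>k. condition_D (S k)" "f \<in> vanishing_ideal \<psi> S E t"
  shows "\<exists>p. f = (\<Sum>\<alpha>\<in>index_set t. p \<alpha> * basis_poly \<psi> S E t \<alpha>) \<and>
    (\<forall>\<alpha>\<in>index_set t. Poly_Mapping.keys (p \<alpha>) + Poly_Mapping.keys (basis_poly \<psi> S E t \<alpha>) \<subseteq> \<Delta> (Poly_Mapping.keys f))"
proof -
  obtain p where p: "f = (\<Sum>\<alpha>\<in>index_set t. p \<alpha> * basis_poly \<psi> S E t \<alpha>)"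
    "\<And>\<alpha> \<kappa>. \<kappa> \<in> Poly_Mapping.keys (p \<alpha>) \<Longrightarrow> \<kappa> + theta \<alpha> \<in> \<Delta> (Poly_Mapping.keys f)"
    using expansion[OF assms] by metis
  have "\<kappa> + \<eta> \<in> \<Delta> (Poly_Mapping.keys f)"
    if \<kappa>: "\<kappa> \<in> Poly_Mapping.keys (p \<alpha>)" and \<eta>: "\<eta> \<in> Poly_Mapping.keys (basis_poly \<psi> S E t \<alpha>)"
    for \<alpha> \<kappa> \<eta>
  proof -
    obtain \<gamma> where \<gamma>: "\<gamma> \<in> Poly_Mapping.keys f" "\<kappa> + theta \<alpha> \<le> \<gamma>"
      using p(2)[OF \<kappa>] by (auto simp: down_closure_def)
    have "\<kappa> + \<eta> \<le> \<kappa> + theta \<alpha>"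
      using greatest_exponent_basis[of \<alpha>] \<eta> by (auto simp: greatest_exponent_def le_fun_def)
    then have "\<kappa> + \<eta> \<le> \<gamma>"
      using \<gamma>(2) by (rule order_trans)
    then show ?thesis
      using \<gamma>(1) by (auto simp: down_closure_def)
  qed
  then show ?thesis
    using p(1) by (intro exI[of _ p]) (auto elim!: set_plus_elim)
qed

section \<open>Condition (D) from the Groebner property\<close>

lemma groebner_exponent:
  assumes "groebner_basis (index_set t) (basis_poly \<psi> S E t) (vanishing_ideal \<psi> S E t)"
    and "tens p \<in> vanishing_ideal \<psi> S E t"
    and deg: "\<And>i. degree (p i) \<le> \<eta> i" and top: "(\<Prod>i\<in>UNIV. coeff (p i) (\<eta> i)) \<noteq> 0"
  obtains r where "r \<in> index_set t" "theta r \<le> \<eta>"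
proof -
  \<comment> \<open>As \<open>tens p\<close> is a nonzero element of the ideal with all exponents
    below \<open>\<eta>\<close>, the Groebner property must place some \<open>theta r\<close> below
    \<open>\<eta>\<close>.\<close>
  have "tens p \<noteq> 0"
    using top by (auto simp flip: lookup_tens)
  then obtain \<alpha> r \<theta> where *: "\<alpha> \<in> Poly_Mapping.keys (tens p)" "r \<in> index_set t"
    "greatest_exponent (basis_poly \<psi> S E t r) \<theta>" "\<theta> \<le> \<alpha>"
    using assms(1,2) unfolding groebner_basis_def by blast
  have "\<theta> = theta r"
    using *(3) greatest_exponent_basis by (rule greatest_exponent_unique)
  moreover have "\<alpha> \<le> \<eta>"
    using deg *(1) by (rule keys_tens_le)
  ultimately show thesis
    using that * order_trans by blast
qed

lemma condition_D_of_groebner_basis: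
  assumes ne: "Pi UNIV S \<noteq> {}" and t: "t \<ge> 2"
    and gb: "groebner_basis (index_set t) (basis_poly \<psi> S E t) (vanishing_ideal \<psi> S E t)"
  shows "condition_D (S k)"
proof (rule ccontr)
  assume "\<not> condition_D (S k)"
  then obtain a b c where ab: "a \<in> S k" "b \<in> S k" "a \<noteq> b" and c: "c \<noteq> 0" "(b - a) * c = 0"
    by (auto simp: condition_D_def zero_divisor_def)
  have dS_pos: "dS i > 0" for i
  proof -
    have "S i \<noteq> {}"
      using ne by auto
    then show ?thesis
      using finite_S psi_pos by (intro sum_pos) auto
  qed
  have sum_single: "sum r UNIV = r k" if "\<And>i. i \<noteq> k \<Longrightarrow> r i = 0" for r :: "'n \<Rightarrow> nat"
  proof -
    have "sum r UNIV = sum r {k}"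
      using that by (intro sum.mono_neutral_right) auto
    then show ?thesis
      by simp
  qed
  show False
  proof (cases "\<exists>j. E j = {}")
    case True
    then obtain j where j: "E j = {}"
      by blast
    have sum_m: "(\<Sum>v\<in>S k. \<psi> k v * t) = t * dS k"
      by (simp add: sum_distrib_left mult.commute)
    \<comment> \<open>With all multiplicities at \<open>k\<close> multiplied by \<open>t\<close> the
      node product is g_k^t; one factor of it is dropped.\<close>
    obtain P where P: "degree P \<le> t * dS k - 1" "coeff P (t * dS k - 1) = c"
      "\<And>v. v \<in> S k \<Longrightarrow> [:- v, 1:] ^ (\<psi> k v * t) dvd P"
      using dropped_node[of "S k" a b "\<lambda>v. \<psi> k v * t" c, OF finite_S ab _ _ c(2)] ab psi_pos t
      unfolding sum_m by simp metis
    define p where "p i = (if i = k then P else 1)" for i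
    define \<eta> where "\<eta> i = (if i = k then t * dS k - 1 else 0)" for i
    have "tens p \<in> vanishing_ideal \<psi> S E t"
    proof (rule tens_in_vanishing_ideal[where w = "\<lambda>i v. if i = k then t else 0"])
      show "[:- v, 1:] ^ (\<psi> i v * (if i = k then t else 0)) dvd p i" if "v \<in> S i" for i v
        using that P(3) by (auto simp: p_def)
    qed simp_all
    moreover have "(\<Prod>i\<in>UNIV. coeff (p i) (\<eta> i)) = (\<Prod>i\<in>UNIV. if i = k then c else 1)"
      using P(2) by (intro prod.cong) (auto simp: p_def \<eta>_def)
    moreover have "degree (p i) \<le> \<eta> i" for i
      using P(1) by (simp add: p_def \<eta>_def)
    ultimately obtain r where r: "r \<in> index_set t" "theta r \<le> \<eta>"
      using groebner_exponent[OF gb, of p \<eta>] c(1) by (auto simp: prod.delta)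
    have le: "theta r i \<le> \<eta> i" for i
      using r(2) by (simp add: le_fun_def)
    have "r i = 0" if "i \<noteq> k" for i
      using le[of i] dS_pos[of i] that by (simp add: theta_def \<eta>_def split: if_splits)
    then have sum: "sum r UNIV = r k"
      by (rule sum_single)
    have pos: "t * dS k > 0"
      using t dS_pos[of k] by simp
    show False
    proof (cases "r k = t")
      case True
      then show False
        using le[of k] sum pos by (simp add: theta_def \<eta>_def)
    next
      case False
      then have rk: "r k = t - 1" "sum r UNIV \<noteq> t"
        using r(1) sum by (auto simp: index_set_def)
      \<comment> \<open>With \<open>E j\<close> empty, g_j/h_j is all of g_j. For total
        \<open>t - 1\<close> this forces \<open>j = k\<close>, and the degree needed at
        \<open>k\<close> is again \<open>t * dS k\<close>, one more than available.\<close>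
      have "dH j = dS j"
        using j by simp
      then have "j = k"
        using le[of j] dS_pos[of j] rk by (auto simp: theta_def \<eta>_def split: if_splits)
      then have "(t - 1) * dS k + dS k \<le> t * dS k - 1"
        using le[of k] rk j by (simp add: theta_def \<eta>_def)
      moreover have "(t - 1) * dS k + dS k = t * dS k"
        using t by (simp add: algebra_simps)
      ultimately show False
        using pos by linarith
    qed
  next
    case False
    \<comment> \<open>Every \<open>E i\<close> is nonempty, so g_i has larger degree than g_i/h_i;
      this excludes \<open>r i > 0\<close> away from \<open>k\<close>.\<close>
    have dH_less: "dH i < dS i" for i
    proof -
      have "dS i = dH i + sum (\<psi> i) (E i)"
        by (rule sum.subset_diff[OF E_sub finite_S])
      moreover have "sum (\<psi> i) (E i) > 0"
        using False E_sub[of i] finite_S psi_pos by (intro sum_pos) (auto intro: finite_subset)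
      ultimately show ?thesis
        by simp
    qed
    \<comment> \<open>The orders of vanishing of \<phi>((t - 1) e_k).\<close>
    let ?w = "\<lambda>i v. (if i = k then t - 1 else 0) + (if v \<in> E i then 0 else 1)"
    have sum_m: "(\<Sum>v\<in>S k. \<psi> k v * ?w k v) = (t - 1) * dS k + dH k"
    proof -
      have "(\<Sum>v\<in>S k. \<psi> k v * ?w k v) = (t - 1) * dS k + (\<Sum>v\<in>S k. if v \<in> E k then 0 else \<psi> k v)"
        unfolding sum_distrib_left sum.distrib[symmetric] by (intro sum.cong) (auto simp: algebra_simps)
      also have "(\<Sum>v\<in>S k. if v \<in> E k then 0 else \<psi> k v) = dH k"
        using finite_S by (intro sum.mono_neutral_cong_right) auto
      finally show ?thesis .
    qed
    \<comment> \<open>Since \<open>t \<ge> 2\<close>, the multiplicities at \<open>a\<close> and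
      \<open>b\<close> are positive even if these nodes lie in \<open>E k\<close>.\<close>
    obtain P where P: "degree P \<le> (t - 1) * dS k + dH k - 1" "coeff P ((t - 1) * dS k + dH k - 1) = c"
      "\<And>v. v \<in> S k \<Longrightarrow> [:- v, 1:] ^ (\<psi> k v * ?w k v) dvd P"
      using dropped_node[of "S k" a b "\<lambda>v. \<psi> k v * ?w k v" c, OF finite_S ab _ _ c(2)] ab psi_pos t
      unfolding sum_m by simp metis
    define p where "p i = (if i = k then P else H i)" for i
    \<comment> \<open>This is \<theta>((t - 1) e_k), lowered by one in coordinate
      \<open>k\<close>.\<close>
    define \<eta> where "\<eta> i = (if i = k then (t - 1) * dS k + dH k - 1 else dH i)" for i
    have "tens p \<in> vanishing_ideal \<psi> S E t"
    proof (rule tens_in_vanishing_ideal[where w = ?w])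
      show "[:- v, 1:] ^ (\<psi> i v * ?w i v) dvd p i" if "v \<in> S i" for i v
      proof (cases "i = k")
        case True
        then show ?thesis
          using P(3)[of v] that by (simp only: p_def if_True refl)
      next
        case False
        then show ?thesis
          using that finite_S by (cases "v \<in> E i") (auto simp: p_def intro!: dvd_prodI)
      qed
      have le: "t - 1 \<le> (\<Sum>i\<in>UNIV. ?w i (x i))" for x
        by (simp add: sum.distrib)
      then show "t \<le> Suc (\<Sum>i\<in>UNIV. ?w i (x i))" for x
        using le[of x] by linarith
      show "t \<le> (\<Sum>i\<in>UNIV. ?w i (x i))" if "x \<in> Pi UNIV S" and x: "x \<notin> Pi UNIV E" for x
      proof -
        obtain i where "x i \<notin> E i"
          using x by auto
        then have "(\<Sum>i\<in>UNIV. if i = k then t - 1 else 0) < (\<Sum>i\<in>UNIV. ?w i (x i))"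
          by (intro sum_strict_mono_ex1) auto
        then show ?thesis
          by simp
      qed
    qed
    moreover have "(\<Prod>i\<in>UNIV. coeff (p i) (\<eta> i)) = (\<Prod>i\<in>UNIV. if i = k then c else 1)"
      using finite_S P(2) by (intro prod.cong) (auto simp: p_def \<eta>_def coeff_node_upoly)
    moreover have "degree (p i) \<le> \<eta> i" for i
      using finite_S P(1) by (simp add: p_def \<eta>_def degree_node_upoly_le)
    ultimately obtain r where r: "r \<in> index_set t" "theta r \<le> \<eta>"
      using groebner_exponent[OF gb, of p \<eta>] c(1) by (auto simp: prod.delta)
    have le: "theta r i \<le> \<eta> i" for i
      using r(2) by (simp add: le_fun_def)
    have "r i = 0" if "i \<noteq> k" for i
    proof (rule ccontr)
      assume "r i \<noteq> 0"
      then have "1 * dS i \<le> r i * dS i"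
        by (intro mult_le_mono1) simp
      then have "dS i \<le> theta r i"
        unfolding theta_def by linarith
      then show False
        using le[of i] dH_less[of i] that by (simp add: \<eta>_def)
    qed
    then have sum: "sum r UNIV = r k"
      by (rule sum_single)
    have pos: "(t - 1) * dS k > 0"
      using t dS_pos[of k] by simp
    have split: "t * dS k = (t - 1) * dS k + dS k"
      using t by (simp add: algebra_simps)
    show False
    \<comment> \<open>Total \<open>t\<close> needs degree \<open>t * dS k\<close>, which exceeds the
      bound as \<open>dH k < dS k\<close>; total \<open>t - 1\<close> misses it by one.\<close>
    proof (cases "r k = t")
      case True
      then have "t * dS k \<le> (t - 1) * dS k + dH k - 1"
        using le[of k] sum by (simp add: theta_def \<eta>_def)
      then show False
        using dH_less[of k] split pos by linarith
    next
      case False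
      then have "r k = t - 1" "sum r UNIV \<noteq> t"
        using r(1) sum by (auto simp: index_set_def)
      then have "theta r k = (t - 1) * dS k + dH k"
        by (simp add: theta_def)
      moreover have "\<eta> k = (t - 1) * dS k + dH k - 1"
        by (simp add: \<eta>_def)
      ultimately show False
        using le[of k] pos by linarith
    qed
  qed
qed

end

theorem theorem5p4:
  fixes S E :: "'n::finite \<Rightarrow> 'a::comm_ring_1 set"
    and \<psi> :: "'n \<Rightarrow> 'a \<Rightarrow> nat"
    and t :: nat
  assumes "\<And>k. finite (S k)"
    and "\<And>k u. u \<in> S k \<Longrightarrow> \<psi> k u > 0"
    and "\<And>k. E k \<subseteq> S k"
    and "t > 0"
  shows "(is_ideal (vanishing_ideal \<psi> S E t) \<and>
      (\<forall>\<alpha>\<in>index_set t. monic (basis_poly \<psi> S E t \<alpha>) \<and>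
        basis_poly \<psi> S E t \<alpha> \<in> vanishing_ideal \<psi> S E t)) \<and>
    ((\<forall>k. condition_D (S k)) \<longrightarrow>
      groebner_basis (index_set t) (basis_poly \<psi> S E t) (vanishing_ideal \<psi> S E t) \<and>
      (\<forall>f\<in>vanishing_ideal \<psi> S E t. \<exists>p :: ('n \<Rightarrow> nat) \<Rightarrow> ('n, 'a) mpoly.
        f = (\<Sum>\<alpha>\<in>index_set t. p \<alpha> * basis_poly \<psi> S E t \<alpha>) \<and>
        (\<forall>\<alpha>\<in>index_set t. Poly_Mapping.keys (p \<alpha>) + Poly_Mapping.keys (basis_poly \<psi> S E t \<alpha>)
          \<subseteq> \<Delta> (Poly_Mapping.keys f)))) \<and>
    (Pi UNIV S \<noteq> {} \<and> t \<ge> 2 \<and>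
      groebner_basis (index_set t) (basis_poly \<psi> S E t) (vanishing_ideal \<psi> S E t) \<longrightarrow>
      (\<forall>k. condition_D (S k)))"
proof -
  interpret nodes S E \<psi> t
    using assms by unfold_locales
  show ?thesis
  proof (intro conjI impI allI ballI)
    show "is_ideal (vanishing_ideal \<psi> S E t)"
      by (rule is_ideal_vanishing_ideal)
  next
    fix \<alpha> :: "'n \<Rightarrow> nat"
    assume "\<alpha> \<in> index_set t"
    then show "Defs.monic (basis_poly \<psi> S E t \<alpha>)" "basis_poly \<psi> S E t \<alpha> \<in> vanishing_ideal \<psi> S E t"
      by (simp_all add: monic_basis basis_in_vanishing_ideal)
  next
    assume "\<forall>k. condition_D (S k)"
    then show "groebner_basis (index_set t) (basis_poly \<psi> S E t) (vanishing_ideal \<psi> S E t)"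
      by (intro groebner_basis) blast
  next
    fix f
    assume "\<forall>k. condition_D (S k)" "f \<in> vanishing_ideal \<psi> S E t"
    then show "\<exists>p :: ('n \<Rightarrow> nat) \<Rightarrow> ('n, 'a) mpoly.
        f = (\<Sum>\<alpha>\<in>index_set t. p \<alpha> * basis_poly \<psi> S E t \<alpha>) \<and>
        (\<forall>\<alpha>\<in>index_set t. Poly_Mapping.keys (p \<alpha>) + Poly_Mapping.keys (basis_poly \<psi> S E t \<alpha>)
          \<subseteq> \<Delta> (Poly_Mapping.keys f))"
      by (intro representation) blast+
  next
    fix k
    assume "Pi UNIV S \<noteq> {} \<and> t \<ge> 2 \<and>
      groebner_basis (index_set t) (basis_poly \<psi> S E t) (vanishing_ideal \<psi> S E t)"
    then show "condition_D (S k)"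
      by (intro condition_D_of_groebner_basis) simp_all
  qed
qed

end
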